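(* Let $h(x)=\mathbb E_\xi[\mathbf H(x,\xi)]$ for $x\in X$, and let $\tilde h_\mu(x)=\mathbb E_\xi[\tilde{\mathbf H}_\mu(x,\xi)]$ with $$\tilde{\mathbf H}_\mu(x,\xi)=\inf_{y\in\mathbb R^d}\left\{\mathbf H(y,\xi)+\mu\,\omega\!\left(\frac{x-y}{\mu}\right)\right\},$$ where $\omega:\mathbb R^d\to\mathbb R$ is convex and $\frac1{\sigma_\omega}$-smooth. Then the following hold. (i) Assume that $\omega^*(y)\le0$ for all $y\in\operatorname{dom}\omega^*$. Then $\tilde h_\mu$ is a smoothing function of $h$ with parameters $(\kappa,K,\mathcal L_h)=\left(\omega(0),\,0,\,\frac1{\sigma_\omega}\right)$. (ii) Assume that $\omega(0)\le0$, $\omega(\cdot)$ is level bounded, the function $\mathbf H(\cdot,\xi)$ is lower semicontinuous and $\inf_{x\in\mathbb R^d}\mathbf H(x,\xi)>-\infty$ for a.e. $\xi\in\Xi$, and $$D[\mathbf H,\omega^*]:=\mathbb E_\xi\left[\sup_{x\in X}\inf_{d\in\partial\mathbf H(x,\xi)}\omega^*(d)\right]<\infty.$$ Then $\tilde h_\mu$ is a smoothing function of $h$ on $X$ with parameters $(\kappa,K,\mathcal L_h)=\left(D[\mathbf H,\omega^*],\,0,\,\frac1{\sigma_\omega}\right)$. (iii) Assume that $\max_{x\in X}\{\|\nabla\omega(x)\|\}<\infty$. Then the unbiasedness and bounded-variance condition holds for the stochastic gradient $\nabla\tilde{\mathbf\Psi}_\mu(x,\zeta)$ with $\zeta=\xi$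 and $\sigma^2=\max_{x\in X}\{\|\nabla\omega(x)\|^2\}$.
   Context: **Setting.** $X\subseteq\mathbb R^d$ is closed and convex; $\xi$ is a random vector with support $\Xi$; $\mathbf H(\cdot,\xi)$ are closed proper convex functions; $h$ is finite-valued and continuous on $X$; $f:X\to\mathbb R$ is convex with Lipschitz gradient. $\|\cdot\|$ is the Euclidean norm. $\bar\mu>0$ is arbitrary. Standing assumption: for any $\mu\in(0,\bar\mu]$, a.e. $\xi\in\Xi$ and any $x\in\mathbb R^d$, $\tilde{\mathbf H}_\mu(x,\xi)$ is finite, and $\inf_{x\in\mathbb R^d}\mathbf H(x,\xi)>-\infty$. "$L$-smooth" means the gradient is Lipschitz with constant $L$. $\omega^*(y)=\sup_x\{\langle x,y\rangle-\omega(x)\}$ is the convex conjugate, $\operatorname{dom}$ denotes the effective domain, $\partial\mathbf H(x,\xi)$ is the subdifferential of $\mathbf H(\cdot,\xi)$ at $x$. **Smoothing function.** For convex $c:X\to\mathbb R$, a function $\tilde c:X\times(0,\bar\mu]\to\mathbb R$ (write $\tilde c_\mu=\tilde c(\cdot,\mu)$) is a smoothing function of $c$ with parameters $(\kappa,K,\mathcal L_c)$ if for every $\mu\in(0,\bar\mu]$, $\tilde c_\mu$ is continuously differentiable on $X$ and: (a) $\lim_{z\to x,\mu\downarrow0}\tilde c(z,\mu)=c(x)$ for all $x\in X$; (b) $\tilde c_\mu$ is convex on $X$; (c) $|\tilde c(x,\mu_2)-\tilde c(x,\mu_1)|\le\kappa|\mu_1-\mu_2|$ for all $x\in X$, $\mu_1,\mu_2\in(0,\bar\mu]$,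 with constant $\kappa>0$; (d) $\nabla\tilde c_\mu$ is Lipschitz on $X$ with constant $K+\mathcal L_c/\mu$, where $K$ and $\mathcal L_c>0$ do not depend on $\mu$. **Stochastic gradient.** $\tilde\psi_\mu=f+\tilde h_\mu$ and $\nabla\tilde{\mathbf\Psi}_\mu(x,\xi)=\nabla f(x)+\nabla\tilde{\mathbf H}_\mu(x,\xi)$, where $\nabla\tilde{\mathbf H}_\mu(x,\xi)=\nabla\omega\big((x-\hat v_\mu(x,\xi))/\mu\big)$ with $\hat v_\mu(x,\xi)$ a minimizer in the definition of $\tilde{\mathbf H}_\mu(x,\xi)$. **Unbiasedness and bounded-variance condition** (with constant $\sigma^2$ independent of $\mu$): for every $x\in X$ and $\mu\in(0,\bar\mu]$, $\mathbb E_\zeta[\nabla\tilde{\mathbf\Psi}_\mu(x,\zeta)]=\nabla\tilde\psi_\mu(x)$ and $\mathbb E_\zeta[\|\nabla\tilde{\mathbf\Psi}_\mu(x,\zeta)-\nabla\tilde\psi_\mu(x)\|^2]\le\sigma^2$.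
   Formalization: (i) adds: for each x in X, a.s. ∂H(x,ξ) meets dom ω*. In (i),(ii), if the stated κ is ≤ 0, the claim is for every κ > 0. (iii) takes the max of ‖∇ω‖ over a set Z a.s. containing the points (x−v̂)/μ (Z = X gives the printed bound), assuming h̃_μ finite on X. *)

theory Defs
  imports "HOL-Probability.Probability"
begin

definition gradient :: "('a::euclidean_space \<Rightarrow> real) \<Rightarrow> 'a \<Rightarrow> 'a" where
  "gradient F x = (THE g. GDERIV F x :> g)"

text \<open>Differentiability on a (closed) set is differentiability, in the ambient space, at each
  point of the set. This makes the gradient unique also when the set has empty interior.\<close>

definition differentiable_grad_on :: "('a::euclidean_space \<Rightarrow> real) \<Rightarrow> 'a set \<Rightarrow> bool" where
  "differentiable_grad_on F S \<longleftrightarrow> (\<forall>x\<in>S. \<exists>g. GDERIV F x :> g)"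

definition smooth_with :: "real \<Rightarrow> 'a::euclidean_space set \<Rightarrow> ('a \<Rightarrow> real) \<Rightarrow> bool" where
  "smooth_with L S F \<longleftrightarrow> differentiable_grad_on F S \<and> L-lipschitz_on S (gradient F)"

definition epigraph :: "('a \<Rightarrow> ereal) \<Rightarrow> ('a \<times> real) set" where
  "epigraph F = {(x, t). F x \<le> ereal t}"

definition closed_proper_convex :: "('a::euclidean_space \<Rightarrow> ereal) \<Rightarrow> bool" where
  "closed_proper_convex F \<longleftrightarrow>
     (\<forall>x. F x \<noteq> -\<infinity>) \<and> (\<exists>x. F x \<noteq> \<infinity>) \<and> convex (epigraph F) \<and> closed (epigraph F)"

definition lower_semicontinuous :: "('a::topological_space \<Rightarrow> ereal) \<Rightarrow> bool" where
  "lower_semicontinuous F \<longleftrightarrow> (\<forall>x. F x \<le> Liminf (at x) F)"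

definition level_bounded :: "('a::metric_space \<Rightarrow> real) \<Rightarrow> bool" where
  "level_bounded F \<longleftrightarrow> (\<forall>\<alpha>. bounded {x. F x \<le> \<alpha>})"

definition effective_domain :: "('a \<Rightarrow> ereal) \<Rightarrow> 'a set" where
  "effective_domain F = {x. F x < \<infinity>}"

definition conjugate :: "('a::real_inner \<Rightarrow> real) \<Rightarrow> 'a \<Rightarrow> ereal" where
  "conjugate F y = (SUP x. ereal (x \<bullet> y - F x))"

text \<open>Empty at points where a proper \<open>F\<close> takes the value \<open>\<infinity>\<close>.\<close>

definition subdifferential :: "('a::real_inner \<Rightarrow> ereal) \<Rightarrow> 'a \<Rightarrow> 'a set" where
  "subdifferential F x = {d. \<forall>y. F x + ereal (d \<bullet> (y - x)) \<le> F y}"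

text \<open>Expectation of an extended real random variable, positive part minus negative part
  (\<open>e2ennreal\<close> truncates negative values to 0).
  If both parts have infinite expectation, the value is \<open>\<infinity>\<close>.\<close>

definition ereal_expectation :: "'s measure \<Rightarrow> ('s \<Rightarrow> ereal) \<Rightarrow> ereal" where
  "ereal_expectation P F =
     enn2ereal (\<integral>\<^sup>+ s. e2ennreal (F s) \<partial>P) - enn2ereal (\<integral>\<^sup>+ s. e2ennreal (- F s) \<partial>P)"

definition rv_support :: "'s measure \<Rightarrow> ('s \<Rightarrow> 'b::topological_space) \<Rightarrow> 'b set" where
  "rv_support P \<xi> = {z. \<forall>U. open U \<longrightarrow> z \<in> U \<longrightarrow> 0 < measure P (\<xi> -` U \<inter> space P)}"

text \<open>The limit in the third conjunct is the joint limit
  \<open>z \<rightarrow> x\<close> (within \<open>X\<close>, \<open>z = x\<close> allowed) and \<open>\<mu> \<down> 0\<close>.\<close>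

definition smoothing_function ::
  "'a::euclidean_space set \<Rightarrow> real \<Rightarrow> ('a \<Rightarrow> real) \<Rightarrow> ('a \<Rightarrow> real \<Rightarrow> real)
     \<Rightarrow> real \<Rightarrow> real \<Rightarrow> real \<Rightarrow> bool" where
  "smoothing_function X \<mu>bar c ctil \<kappa> K L \<longleftrightarrow>
     convex_on X c \<and>
     (\<forall>\<mu>\<in>{0<..\<mu>bar}. differentiable_grad_on (\<lambda>x. ctil x \<mu>) X
                       \<and> continuous_on X (gradient (\<lambda>x. ctil x \<mu>))) \<and>
     (\<forall>x\<in>X. ((\<lambda>p. ctil (fst p) (snd p)) \<longlongrightarrow> c x) (at (x, 0) within X \<times> {0<..\<mu>bar})) \<and>
     (\<forall>\<mu>\<in>{0<..\<mu>bar}. convex_on X (\<lambda>x. ctil x \<mu>)) \<and>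
     \<kappa> > 0 \<and>
     (\<forall>x\<in>X. \<forall>\<mu>1\<in>{0<..\<mu>bar}. \<forall>\<mu>2\<in>{0<..\<mu>bar}.
        \<bar>ctil x \<mu>2 - ctil x \<mu>1\<bar> \<le> \<kappa> * \<bar>\<mu>1 - \<mu>2\<bar>) \<and>
     L > 0 \<and>
     (\<forall>\<mu>\<in>{0<..\<mu>bar}. (K + L / \<mu>)-lipschitz_on X (gradient (\<lambda>x. ctil x \<mu>)))"

definition inf_conv_objective ::
  "('a::euclidean_space \<Rightarrow> 'b \<Rightarrow> ereal) \<Rightarrow> ('a \<Rightarrow> real) \<Rightarrow> real \<Rightarrow> 'a \<Rightarrow> 'b \<Rightarrow> 'a \<Rightarrow> ereal" where
  "inf_conv_objective H \<omega> \<mu> x z y = H y z + ereal (\<mu> * \<omega> ((x - y) /\<^sub>R \<mu>))"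

definition H_tilde ::
  "('a::euclidean_space \<Rightarrow> 'b \<Rightarrow> ereal) \<Rightarrow> ('a \<Rightarrow> real) \<Rightarrow> real \<Rightarrow> 'a \<Rightarrow> 'b \<Rightarrow> ereal" where
  "H_tilde H \<omega> \<mu> x z = (INF y. inf_conv_objective H \<omega> \<mu> x z y)"

definition expected_H_tilde ::
  "'s measure \<Rightarrow> ('s \<Rightarrow> 'b) \<Rightarrow> ('a::euclidean_space \<Rightarrow> 'b \<Rightarrow> ereal) \<Rightarrow> ('a \<Rightarrow> real)
     \<Rightarrow> 'a \<Rightarrow> real \<Rightarrow> ereal" where
  "expected_H_tilde P \<xi> H \<omega> x \<mu> = ereal_expectation P (\<lambda>s. H_tilde H \<omega> \<mu> x (\<xi> s))"

text \<open>Real-valued version, meaningful where \<open>expected_H_tilde\<close> is finite.\<close>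

definition h_tilde ::
  "'s measure \<Rightarrow> ('s \<Rightarrow> 'b) \<Rightarrow> ('a::euclidean_space \<Rightarrow> 'b \<Rightarrow> ereal) \<Rightarrow> ('a \<Rightarrow> real)
     \<Rightarrow> 'a \<Rightarrow> real \<Rightarrow> real" where
  "h_tilde P \<xi> H \<omega> x \<mu> = real_of_ereal (expected_H_tilde P \<xi> H \<omega> x \<mu>)"

definition D_const ::
  "'s measure \<Rightarrow> ('s \<Rightarrow> 'b) \<Rightarrow> 'a::euclidean_space set \<Rightarrow> ('a \<Rightarrow> 'b \<Rightarrow> ereal)
     \<Rightarrow> ('a \<Rightarrow> ereal) \<Rightarrow> ereal" where
  "D_const P \<xi> X H \<omega>star =
     ereal_expectation P
       (\<lambda>s. SUP x\<in>X. INF d\<in>subdifferential (\<lambda>y. H y (\<xi> s)) x. \<omega>star d)"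

definition psi_tilde ::
  "'s measure \<Rightarrow> ('s \<Rightarrow> 'b) \<Rightarrow> ('a::euclidean_space \<Rightarrow> 'b \<Rightarrow> ereal) \<Rightarrow> ('a \<Rightarrow> real)
     \<Rightarrow> ('a \<Rightarrow> real) \<Rightarrow> real \<Rightarrow> 'a \<Rightarrow> real" where
  "psi_tilde P \<xi> H \<omega> f \<mu> x = f x + h_tilde P \<xi> H \<omega> x \<mu>"

text \<open>The argument \<open>v \<mu> x z\<close> is the selected minimizer in the definition of \<open>H_tilde\<close>.\<close>

definition grad_H_tilde ::
  "('a::euclidean_space \<Rightarrow> real) \<Rightarrow> (real \<Rightarrow> 'a \<Rightarrow> 'b \<Rightarrow> 'a) \<Rightarrow> real \<Rightarrow> 'a \<Rightarrow> 'b \<Rightarrow> 'a" where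
  "grad_H_tilde \<omega> v \<mu> x z = gradient \<omega> ((x - v \<mu> x z) /\<^sub>R \<mu>)"

definition stoch_grad ::
  "('a::euclidean_space \<Rightarrow> real) \<Rightarrow> ('a \<Rightarrow> real) \<Rightarrow> (real \<Rightarrow> 'a \<Rightarrow> 'b \<Rightarrow> 'a)
     \<Rightarrow> real \<Rightarrow> 'a \<Rightarrow> 'b \<Rightarrow> 'a" where
  "stoch_grad f \<omega> v \<mu> x z = gradient f x + grad_H_tilde \<omega> v \<mu> x z"

text \<open>Integrability and differentiability are required explicitly because the integral and the
  gradient are total functions.\<close>

definition unbiased_bounded_variance ::
  "'s measure \<Rightarrow> ('s \<Rightarrow> 'b) \<Rightarrow> 'a::euclidean_space set \<Rightarrow> real \<Rightarrow> (real \<Rightarrow> 'a \<Rightarrow> real)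
     \<Rightarrow> (real \<Rightarrow> 'a \<Rightarrow> 'b \<Rightarrow> 'a) \<Rightarrow> real \<Rightarrow> bool" where
  "unbiased_bounded_variance P \<zeta> X \<mu>bar \<psi> G \<sigma>2 \<longleftrightarrow>
     (\<forall>x\<in>X. \<forall>\<mu>\<in>{0<..\<mu>bar}.
        (\<exists>g. GDERIV (\<psi> \<mu>) x :> g) \<and>
        integrable P (\<lambda>s. G \<mu> x (\<zeta> s)) \<and>
        (\<integral>s. G \<mu> x (\<zeta> s) \<partial>P) = gradient (\<psi> \<mu>) x \<and>
        integrable P (\<lambda>s. (norm (G \<mu> x (\<zeta> s) - gradient (\<psi> \<mu>) x))\<^sup>2) \<and>
        (\<integral>s. (norm (G \<mu> x (\<zeta> s) - gradient (\<psi> \<mu>) x))\<^sup>2 \<partial>P) \<le> \<sigma>2)"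

end

theory Submission
  imports Defs
begin

text \<open>
  Write \<open>e \<mu> x\<close> for the infimal convolution of \<open>H\<close> (at a fixed realization of the random vector)
  with the perspective \<open>\<mu> \<omega>(\<cdot> / \<mu>)\<close>. Everything follows from estimates on function values of \<open>e\<close> that
  hold almost surely and survive taking expectations.

  Smoothness. For convex functions that are finite on the whole space, the bound
  \<open>g (x + u) + g (x - u) - 2 g x \<le> M |u|\<^sup>2\<close> implies that the gradient exists and is Lipschitz with
  constant \<open>M\<close> (\<open>smooth_with_of_second_difference\<close>). The perspective satisfies it with \<open>M = 1 / (\<sigma>\<omega> \<mu>)\<close>,
  infimal convolution inherits it by inserting a near minimizer for \<open>x\<close> at \<open>x + u\<close> and \<open>x - u\<close>, and so
  does the expectation. In particular the infimum need not be attained. To have gradients in the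
  ambient space at points of \<open>X\<close>, the expectation must be finite around them; by convexity it is
  finite everywhere as soon as \<open>H\<close> and \<open>e \<mu>\<close> are integrable at one point of \<open>X\<close>
  (\<open>env_integrable\<close>).

  Dependence on \<open>\<mu>\<close>. For \<open>\<mu>1 \<le> \<mu>2\<close> convexity of \<open>\<omega>\<close> gives \<open>e \<mu>2 \<le> e \<mu>1 + (\<mu>2 - \<mu>1) \<omega>(0)\<close>, and
  convexity of \<open>H\<close> shows that \<open>e \<mu>1\<close> lies below the chord from \<open>H\<close> (at parameter zero) to \<open>e \<mu>2\<close>. A
  subgradient \<open>d\<close> of \<open>H\<close> at \<open>x\<close> gives \<open>H x - \<mu> \<omega>\<^sup>*(d) \<le> e \<mu> x\<close>. If conjugate values are nonpositive,
  then \<open>H \<le> e \<mu>\<close>, so that \<open>e\<close> is nondecreasing in \<open>\<mu>\<close> with rate at most \<open>\<omega>(0)\<close>. If instead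
  \<open>\<omega>(0) \<le> 0\<close>, then \<open>e\<close> is nonincreasing in \<open>\<mu>\<close> and, by the chord bound, its rate of decrease from
  \<open>\<mu>1\<close> to \<open>\<mu>2\<close> is at most \<open>(H - e \<mu>2) / \<mu>2\<close>, which lies below the conjugate at every subgradient; the expectation of this
  quotient is at most \<open>D\<close>. In both cases the mean of \<open>e \<mu>\<close> differs from \<open>h\<close> by at most a multiple
  of \<open>\<mu>\<close>, and continuity of \<open>h\<close> gives the joint limit.

  Stochastic gradient. The objective with its minimizer frozen touches \<open>e \<mu>\<close> from above at \<open>x\<close>, so \<open>e \<mu>\<close>
  differs from its linearization with the sampled gradient by at most a quadratic. Integrating this
  identifies the gradient of the mean (\<open>GDERIV_mean_env\<close>), and the variance is at most the second
  moment of the sampled gradient.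
\<close>

section \<open>Smoothness of convex functions through second differences\<close>

lemma gradient_eqI: "GDERIV F x :> g \<Longrightarrow> gradient F x = g"
proof -
  assume g: "GDERIV F x :> g"
  have "g' = g" if "GDERIV F x :> g'" for g'
  proof -
    have "(\<lambda>h. h \<bullet> g') = (\<lambda>h. h \<bullet> g)"
      using g that unfolding gderiv_def by (rule has_derivative_unique[rotated])
    then show ?thesis by (metis inner_commute vector_eq_rdot)
  qed
  then show ?thesis unfolding gradient_def using g by (blast intro: the_equality)
qed

lemma GDERIV_of_quadratic_bound:
  fixes g :: "'a::euclidean_space \<Rightarrow> real"
  assumes "\<And>u. \<bar>g (x + u) - g x - p \<bullet> u\<bar> \<le> M * (norm u)\<^sup>2"
  shows "GDERIV g x :> p"
  unfolding gderiv_def has_derivative_at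
proof (intro conjI bounded_linear_inner_left)
  have "\<bar>norm (g (x + h) - g x - h \<bullet> p) / norm h\<bar> \<le> M * norm h" for h
    using assms[of h]
    by (cases "h = 0") (auto simp: inner_commute divide_simps power2_eq_square)
  then have "\<forall>\<^sub>F h in at 0. norm (norm (g (x + h) - g x - h \<bullet> p) / norm h) \<le> M * norm h"
    by (intro always_eventually) simp
  moreover have "((\<lambda>h::'a. M * norm h) \<longlongrightarrow> 0) (at 0)"
    by (auto intro!: tendsto_eq_intros)
  ultimately show "((\<lambda>h. norm (g (x + h) - g x - h \<bullet> p) / norm h) \<longlongrightarrow> 0) (at 0)"
    by (rule Lim_null_comparison)
qed

text \<open>The difference of the two sides is nonpositive at \<open>u\<close> because, along the segment from
  \<open>x\<close> to \<open>x + u\<close>, its derivative is a gradient increment minus its Lipschitz bound.\<close>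

lemma smooth_with_descent:
  fixes F :: "'a::euclidean_space \<Rightarrow> real"
  assumes "smooth_with L UNIV F"
  shows "F (x + u) \<le> F x + gradient F x \<bullet> u + L / 2 * (norm u)\<^sup>2"
proof -
  define k where "k t = F (x + t *\<^sub>R u) - t * (gradient F x \<bullet> u) - L / 2 * t\<^sup>2 * (norm u)\<^sup>2" for t
  have deriv: "DERIV k t :> gradient F (x + t *\<^sub>R u) \<bullet> u - gradient F x \<bullet> u - L * t * (norm u)\<^sup>2" for t
  proof -
    obtain g where "GDERIV F (x + t *\<^sub>R u) :> g"
      using assms by (auto simp: smooth_with_def differentiable_grad_on_def)
    then have "(F has_derivative (\<lambda>h. h \<bullet> gradient F (x + t *\<^sub>R u))) (at (x + t *\<^sub>R u))"
      using gradient_eqI gderiv_def by metis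
    then have "((\<lambda>t. F (x + t *\<^sub>R u)) has_derivative (\<lambda>h. (h *\<^sub>R u) \<bullet> gradient F (x + t *\<^sub>R u))) (at t)"
      by (rule has_derivative_compose[rotated]) (auto intro!: derivative_eq_intros)
    then have "DERIV (\<lambda>t. F (x + t *\<^sub>R u)) t :> gradient F (x + t *\<^sub>R u) \<bullet> u"
      by (rule has_derivative_imp_has_field_derivative) (simp add: inner_commute)
    then show ?thesis unfolding k_def
      by (auto intro!: derivative_eq_intros)
  qed
  have "k 1 \<le> k 0"
  proof (rule DERIV_nonpos_imp_nonincreasing[of 0 1 k])
    fix t :: real assume t: "0 \<le> t" "t \<le> 1"
    have "(gradient F (x + t *\<^sub>R u) - gradient F x) \<bullet> u
        \<le> norm (gradient F (x + t *\<^sub>R u) - gradient F x) * norm u" by (rule norm_cauchy_schwarz)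
    also have "\<dots> \<le> (L * norm (t *\<^sub>R u)) * norm u"
      using assms lipschitz_onD[of L UNIV "gradient F" "x + t *\<^sub>R u" x]
      by (intro mult_right_mono) (auto simp: smooth_with_def dist_norm)
    also have "\<dots> = L * t * (norm u)\<^sup>2" using t by (simp add: power2_eq_square)
    finally show "\<exists>y. DERIV k t :> y \<and> y \<le> 0" using deriv[of t]
      by (auto simp: inner_diff_left)
  qed simp
  then show ?thesis by (simp add: k_def)
qed

text \<open>A subgradient is the slope of a hyperplane separating the point \<open>(x, g x)\<close> from the strict
  epigraph. The hyperplane cannot be vertical because \<open>g\<close> is finite on the whole space.\<close>

lemma convex_on_imp_subgradient:
  fixes g :: "'a::euclidean_space \<Rightarrow> real"
  assumes g: "convex_on UNIV g"
  shows "\<exists>p. \<forall>u. g x + p \<bullet> u \<le> g (x + u)"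
proof -
  let ?S = "{(x, g x)}" and ?T = "{(y, t). g y < t}"
  have "convex ?T"
  proof (rule convexI, clarsimp)
    fix y1 y2 t1 t2 u v
    assume *: "g y1 < t1" "g y2 < t2" "(0::real) \<le> u" "0 \<le> v" "u + v = 1"
    have "g (u *\<^sub>R y1 + v *\<^sub>R y2) \<le> u * g y1 + v * g y2"
      using g * by (auto simp: convex_on_def)
    also have "\<dots> < u * t1 + v * t2"
      using * by (cases "u = 0") (auto intro!: add_less_le_mono mult_left_mono)
    finally show "g (u *\<^sub>R y1 + v *\<^sub>R y2) < u * t1 + v * t2" .
  qed
  moreover have "?T \<noteq> {}" using less_add_one by blast
  ultimately obtain a b where ab: "a \<noteq> 0" "\<forall>z\<in>?S. a \<bullet> z \<le> b" "\<forall>z\<in>?T. b \<le> a \<bullet> z"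
    using separating_hyperplane_sets[of ?S ?T] by auto
  obtain c r where a: "a = (c, r)" by (cases a)
  have sep: "c \<bullet> x + r * g x \<le> c \<bullet> y + r * t" if "g y < t" for y t
    using ab that by (fastforce simp: a)
  have "0 \<le> r" using sep[of x "g x + 1"] by (simp add: algebra_simps)
  moreover have "r \<noteq> 0"
  proof
    assume r: "r = 0"
    have "c \<bullet> x \<le> c \<bullet> (x - c)" using sep[of "x - c" "g (x - c) + 1"] r by simp
    then have "c = 0" using inner_gt_zero_iff[of c] by (fastforce simp: inner_diff_right)
    then show False using ab(1) a r by (simp add: zero_prod_def)
  qed
  ultimately have r: "0 < r" by simp
  have "g x + (- c /\<^sub>R r) \<bullet> u \<le> g (x + u)" for u
  proof (rule field_le_epsilon)
    fix e :: real assume "0 < e"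
    then have "r * g x \<le> c \<bullet> u + r * (g (x + u) + e)"
      using sep[of "x + u" "g (x + u) + e"] by (simp add: inner_add_right)
    moreover have "(- c /\<^sub>R r) \<bullet> u = - (c \<bullet> u) / r" by (simp add: divide_inverse)
    then have "r * (g x + (- c /\<^sub>R r) \<bullet> u) = r * g x - c \<bullet> u"
      using r by (simp add: field_simps)
    ultimately have "r * (g x + (- c /\<^sub>R r) \<bullet> u) \<le> r * (g (x + u) + e)"
      by (simp add: distrib_left)
    then show "g x + (- c /\<^sub>R r) \<bullet> u \<le> g (x + u) + e" using r by simp
  qed
  then show ?thesis by blast
qed

text \<open>Bounding the second difference at \<open>x\<close> alone would give the constant \<open>M\<close> in place of
  \<open>M / 2\<close>. Doubling the step improves any constant \<open>C\<close> to \<open>(C + M / 2) / 2\<close>, and iterating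
  this drives the constant to the fixed point \<open>M / 2\<close>. The sharp value matters: it is what makes
  the Lipschitz constant of the gradient equal to \<open>M\<close>.\<close>

lemma second_difference_imp_quadratic_bound:
  fixes g :: "'a::euclidean_space \<Rightarrow> real"
  assumes sub: "\<And>u. g x + p \<bullet> u \<le> g (x + u)"
    and sd: "\<And>x u. g (x + u) + g (x - u) - 2 * g x \<le> M * (norm u)\<^sup>2"
  shows "g (x + u) \<le> g x + p \<bullet> u + M / 2 * (norm u)\<^sup>2"
proof -
  define r where "r u = g (x + u) - g x - p \<bullet> u" for u
  have double: "r (2 *\<^sub>R u) \<le> 2 * r u + M * (norm u)\<^sup>2" for u
    using sd[of "x + u" u] by (simp add: r_def scaleR_2 algebra_simps)
  \<comment> \<open>The constants \<open>M / 2 * (1 + (1/2)^n)\<close> are the iterates of the improvement step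
      started at \<open>M\<close>.\<close>
  have step: "\<forall>u. r u \<le> M / 2 * (1 + (1/2)^n) * (norm u)\<^sup>2" for n :: nat
  proof (induction n)
    case 0
    have "r u \<le> M * (norm u)\<^sup>2" for u
      using sd[of x u] sub[of "-u"] by (simp add: r_def)
    then show ?case by simp
  next
    case (Suc n)
    show ?case
    proof
      fix u
      have "r u \<le> 2 * r (u /\<^sub>R 2) + M * (norm (u /\<^sub>R 2))\<^sup>2" using double[of "u /\<^sub>R 2"] by simp
      also have "\<dots> \<le> 2 * (M / 2 * (1 + (1/2)^n) * (norm (u /\<^sub>R 2))\<^sup>2) + M * (norm (u /\<^sub>R 2))\<^sup>2"
        using Suc.IH[rule_format, of "u /\<^sub>R 2"] by linarith
      also have "\<dots> = M / 2 * (1 + (1/2)^Suc n) * (norm u)\<^sup>2"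
        by (simp add: field_simps power2_eq_square)
      finally show "r u \<le> M / 2 * (1 + (1/2)^Suc n) * (norm u)\<^sup>2" .
    qed
  qed
  have "(\<lambda>n. M / 2 * (1 + (1/2)^n) * (norm u)\<^sup>2) \<longlonglongrightarrow> M / 2 * (1 + 0) * (norm u)\<^sup>2"
    by (intro tendsto_intros LIMSEQ_realpow_zero) auto
  then have "r u \<le> M / 2 * (1 + 0) * (norm u)\<^sup>2"
    by (rule LIMSEQ_le_const) (use step in auto)
  then show ?thesis by (simp add: r_def)
qed

text \<open>Unlike a gradient, a second-difference bound refers to function values only, so it survives both
  infima and expectations; here smoothness is recovered from it. The two-sided bound by a
  subgradient and a quadratic gives differentiability. Minimizing the quadratic upper bound at
  \<open>y\<close> against the affine lower bound at \<open>x\<close> gives cocoercivity of the gradient, and hence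
  the Lipschitz constant.\<close>

lemma smooth_with_of_second_difference:
  fixes g :: "'a::euclidean_space \<Rightarrow> real"
  assumes g: "convex_on UNIV g" and M: "0 < M"
    and sd: "\<And>x u. g (x + u) + g (x - u) - 2 * g x \<le> M * (norm u)\<^sup>2"
  shows "smooth_with M UNIV g"
proof -
  obtain p where sub: "\<And>x u. g x + p x \<bullet> u \<le> g (x + u)"
    using convex_on_imp_subgradient[OF g] by metis
  have quad: "g (x + u) \<le> g x + p x \<bullet> u + M / 2 * (norm u)\<^sup>2" for x u
    by (rule second_difference_imp_quadratic_bound[OF sub sd])
  have G: "GDERIV g x :> p x" for x
  proof (rule GDERIV_of_quadratic_bound)
    show "\<bar>g (x + u) - g x - p x \<bullet> u\<bar> \<le> M / 2 * (norm u)\<^sup>2" for u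
      using sub[of x u] quad[of x u] by simp
  qed
  then have grad: "gradient g = p" using gradient_eqI by blast
  have coco: "g x + p x \<bullet> (y - x) + (norm (p y - p x))\<^sup>2 / (2 * M) \<le> g y" for x y
  proof -
    define q where "q = p y - p x"
    \<comment> \<open>The minimizer of the quadratic upper bound at \<open>y\<close>, tilted by the slope \<open>p x\<close>.\<close>
    let ?u = "- (q /\<^sub>R M)"
    have "g x + p x \<bullet> (y - x + ?u) \<le> g y + p y \<bullet> ?u + M / 2 * (norm ?u)\<^sup>2"
      using sub[of x "y - x + ?u"] quad[of y ?u] by simp
    then have "g x + p x \<bullet> (y - x) + q \<bullet> (q /\<^sub>R M) - M / 2 * (norm ?u)\<^sup>2 \<le> g y"
      by (simp add: q_def algebra_simps inner_diff_left)
    moreover have "q \<bullet> (q /\<^sub>R M) - M / 2 * (norm ?u)\<^sup>2 = (norm q)\<^sup>2 / (2 * M)"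
      using M by (simp add: dot_square_norm power_mult_distrib field_simps power2_eq_square)
    ultimately show ?thesis by (simp add: q_def)
  qed
  have "norm (p y - p x) \<le> M * norm (y - x)" for x y
  proof (cases "p y = p x")
    case False
    let ?q = "p y - p x"
    have "(norm ?q)\<^sup>2 / M \<le> ?q \<bullet> (y - x)"
      using coco[of x y] coco[of y x] M
      by (simp add: norm_minus_commute inner_diff_left inner_diff_right field_simps)
    also have "\<dots> \<le> norm ?q * norm (y - x)" by (rule norm_cauchy_schwarz)
    finally have "norm ?q * norm ?q \<le> norm ?q * (M * norm (y - x))"
      using M by (simp add: field_simps power2_eq_square)
    then show ?thesis using False by simp
  qed (use M in simp)
  then have "M-lipschitz_on UNIV p"
    using M by (intro lipschitz_onI) (auto simp: dist_norm norm_minus_commute)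
  with G show ?thesis by (auto simp: smooth_with_def differentiable_grad_on_def grad)
qed

section \<open>Infimal convolution with a smooth convex function\<close>

definition perspective :: "('a::real_vector \<Rightarrow> real) \<Rightarrow> real \<Rightarrow> 'a \<Rightarrow> real" where
  "perspective \<omega> \<mu> u = \<mu> * \<omega> (u /\<^sub>R \<mu>)"

definition inf_conv :: "('a::real_vector \<Rightarrow> ereal) \<Rightarrow> ('a \<Rightarrow> real) \<Rightarrow> 'a \<Rightarrow> ereal" where
  "inf_conv F W x = (INF y. F y + ereal (W (x - y)))"

lemma H_tilde_eq_inf_conv: "H_tilde H \<omega> \<mu> x z = inf_conv (\<lambda>y. H y z) (perspective \<omega> \<mu>) x"
  by (simp add: H_tilde_def inf_conv_objective_def inf_conv_def perspective_def)

lemma convex_on_perspective: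
  fixes \<omega> :: "'a::real_vector \<Rightarrow> real"
  assumes "convex_on UNIV \<omega>" "0 < \<mu>"
  shows "convex_on UNIV (perspective \<omega> \<mu>)"
proof (rule convex_onI)
  fix t :: real and x y :: 'a assume t: "0 < t" "t < 1"
  have "\<omega> (((1 - t) *\<^sub>R x + t *\<^sub>R y) /\<^sub>R \<mu>) \<le> (1 - t) * \<omega> (x /\<^sub>R \<mu>) + t * \<omega> (y /\<^sub>R \<mu>)"
    using convex_onD[OF assms(1), of t "x /\<^sub>R \<mu>" "y /\<^sub>R \<mu>"] t
    by (simp add: scaleR_add_right scaleR_left_commute mult.commute)
  then have "\<mu> * \<omega> (((1 - t) *\<^sub>R x + t *\<^sub>R y) /\<^sub>R \<mu>)
      \<le> \<mu> * ((1 - t) * \<omega> (x /\<^sub>R \<mu>) + t * \<omega> (y /\<^sub>R \<mu>))"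
    using assms(2) by (intro mult_left_mono) auto
  then show "perspective \<omega> \<mu> ((1 - t) *\<^sub>R x + t *\<^sub>R y)
      \<le> (1 - t) * perspective \<omega> \<mu> x + t * perspective \<omega> \<mu> y"
    by (simp add: perspective_def algebra_simps)
qed simp

lemma perspective_quadratic_bound:
  fixes \<omega> :: "'a::euclidean_space \<Rightarrow> real"
  assumes "smooth_with L UNIV \<omega>" "0 < \<mu>"
  shows "perspective \<omega> \<mu> (a + u)
    \<le> perspective \<omega> \<mu> a + gradient \<omega> (a /\<^sub>R \<mu>) \<bullet> u + L / \<mu> / 2 * (norm u)\<^sup>2"
proof -
  have "\<mu> * \<omega> (a /\<^sub>R \<mu> + u /\<^sub>R \<mu>)
      \<le> \<mu> * (\<omega> (a /\<^sub>R \<mu>) + gradient \<omega> (a /\<^sub>R \<mu>) \<bullet> (u /\<^sub>R \<mu>) + L / 2 * (norm (u /\<^sub>R \<mu>))\<^sup>2)"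
    by (rule mult_left_mono[OF smooth_with_descent[OF assms(1)] less_imp_le[OF assms(2)]])
  also have "\<dots> = perspective \<omega> \<mu> a + gradient \<omega> (a /\<^sub>R \<mu>) \<bullet> u + L / \<mu> / 2 * (norm u)\<^sup>2"
    using assms(2) by (simp add: perspective_def field_simps power2_eq_square)
  finally show ?thesis by (simp add: perspective_def scaleR_add_right)
qed

text \<open>The first-order terms of the quadratic bounds in the directions \<open>u\<close> and \<open>- u\<close> cancel.\<close>

lemma perspective_second_difference:
  fixes \<omega> :: "'a::euclidean_space \<Rightarrow> real"
  assumes "smooth_with L UNIV \<omega>" "0 < \<mu>"
  shows "perspective \<omega> \<mu> (a + u) + perspective \<omega> \<mu> (a - u) - 2 * perspective \<omega> \<mu> a
    \<le> L / \<mu> * (norm u)\<^sup>2"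
  using perspective_quadratic_bound[OF assms, of a u] perspective_quadratic_bound[OF assms, of a "-u"]
  by simp

text \<open>The point \<open>u / \<mu>2\<close> lies on the segment between \<open>u / \<mu>1\<close> and \<open>0\<close>.\<close>

lemma perspective_le_add:
  fixes \<omega> :: "'a::real_vector \<Rightarrow> real"
  assumes "convex_on UNIV \<omega>" "0 < \<mu>1" "\<mu>1 \<le> \<mu>2"
  shows "perspective \<omega> \<mu>2 u \<le> perspective \<omega> \<mu>1 u + (\<mu>2 - \<mu>1) * \<omega> 0"
proof -
  define l where "l = \<mu>1 / \<mu>2"
  have "\<omega> (l *\<^sub>R (u /\<^sub>R \<mu>1)) \<le> l * \<omega> (u /\<^sub>R \<mu>1) + (1 - l) * \<omega> 0"
    using convex_onD[OF assms(1), of l 0 "u /\<^sub>R \<mu>1"] assms by (simp add: l_def)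
  moreover have "l *\<^sub>R (u /\<^sub>R \<mu>1) = u /\<^sub>R \<mu>2"
    using assms by (simp add: l_def field_simps)
  ultimately have "\<omega> (u /\<^sub>R \<mu>2) \<le> \<mu>1 / \<mu>2 * \<omega> (u /\<^sub>R \<mu>1) + (1 - \<mu>1 / \<mu>2) * \<omega> 0"
    by (metis l_def)
  then have "\<mu>2 * \<omega> (u /\<^sub>R \<mu>2) \<le> \<mu>2 * (\<mu>1 / \<mu>2 * \<omega> (u /\<^sub>R \<mu>1) + (1 - \<mu>1 / \<mu>2) * \<omega> 0)"
    using assms by (intro mult_left_mono) auto
  also have "\<dots> = \<mu>1 * \<omega> (u /\<^sub>R \<mu>1) + (\<mu>2 - \<mu>1) * \<omega> 0"
    using assms by (simp add: field_simps)
  finally show ?thesis by (simp add: perspective_def)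
qed

text \<open>Unlike the usual notion of a proper function, this one admits the constant \<open>\<infinity>\<close>; finiteness of
  an infimal convolution rules it out.\<close>

definition proper_convex :: "('a::real_vector \<Rightarrow> ereal) \<Rightarrow> bool" where
  "proper_convex F \<longleftrightarrow> (\<forall>x. F x \<noteq> -\<infinity>) \<and> convex (epigraph F)"

lemma proper_convexD:
  assumes "proper_convex F" "F x = ereal a" "F y = ereal b" "0 \<le> t" "t \<le> 1"
  obtains c where "F ((1 - t) *\<^sub>R x + t *\<^sub>R y) = ereal c" "c \<le> (1 - t) * a + t * b"
proof -
  have "(1 - t) *\<^sub>R (x, a) + t *\<^sub>R (y, b) \<in> epigraph F"
    using assms by (intro convexD) (auto simp: proper_convex_def epigraph_def)
  then have "F ((1 - t) *\<^sub>R x + t *\<^sub>R y) \<le> ereal ((1 - t) * a + t * b)"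
    by (simp add: epigraph_def)
  then show ?thesis using that assms(1) unfolding proper_convex_def
    by (cases "F ((1 - t) *\<^sub>R x + t *\<^sub>R y)") auto
qed

text \<open>The infimum need not be attained. All estimates on the infimal convolution therefore go through
  points that minimize up to an arbitrary positive error.\<close>

locale finite_inf_conv =
  fixes F :: "'a::real_vector \<Rightarrow> ereal" and W :: "'a \<Rightarrow> real"
  assumes proper: "proper_convex F"
    and finite: "\<And>x. \<bar>inf_conv F W x\<bar> \<noteq> \<infinity>"
begin

abbreviation env :: "'a \<Rightarrow> real" where
  "env x \<equiv> real_of_ereal (inf_conv F W x)"

lemma env_le: "F y = ereal a \<Longrightarrow> env x \<le> a + W (x - y)"
proof -
  assume "F y = ereal a"
  then have "inf_conv F W x \<le> ereal (a + W (x - y))"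
    unfolding inf_conv_def by (intro INF_lower2[of y]) auto
  then show ?thesis using finite[of x] by (cases "inf_conv F W x") auto
qed

lemma near_minimizer:
  assumes "0 < e"
  obtains y a where "F y = ereal a" "a + W (x - y) < env x + e"
proof -
  have "inf_conv F W x < ereal (env x + e)"
    using finite[of x] assms by (cases "inf_conv F W x") auto
  then obtain y where y: "F y + ereal (W (x - y)) < ereal (env x + e)"
    unfolding inf_conv_def INF_less_iff by auto
  moreover have "F y \<noteq> -\<infinity>" using proper by (auto simp: proper_convex_def)
  ultimately show ?thesis using that[of y] by (cases "F y") auto
qed

text \<open>The objective is jointly convex in both arguments; the infimum over one of them is convex.\<close>

lemma convex_on_env:
  assumes W: "convex_on UNIV W"
  shows "convex_on UNIV env"
proof (rule convex_onI)
  fix t :: real and x1 x2 :: 'a assume t: "0 < t" "t < 1"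
  let ?x = "(1 - t) *\<^sub>R x1 + t *\<^sub>R x2"
  show "env ?x \<le> (1 - t) * env x1 + t * env x2"
  proof (rule field_le_epsilon)
    fix e :: real assume e: "0 < e"
    obtain y1 a1 where 1: "F y1 = ereal a1" "a1 + W (x1 - y1) < env x1 + e"
      using e by (rule near_minimizer)
    obtain y2 a2 where 2: "F y2 = ereal a2" "a2 + W (x2 - y2) < env x2 + e"
      using e by (rule near_minimizer)
    let ?y = "(1 - t) *\<^sub>R y1 + t *\<^sub>R y2"
    obtain c where c: "F ?y = ereal c" "c \<le> (1 - t) * a1 + t * a2"
      using proper_convexD[OF proper 1(1) 2(1), of t] t by auto
    have "env ?x \<le> c + W (?x - ?y)" by (rule env_le[OF c(1)])
    also have "?x - ?y = (1 - t) *\<^sub>R (x1 - y1) + t *\<^sub>R (x2 - y2)"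
      by (simp add: algebra_simps)
    also have "W \<dots> \<le> (1 - t) * W (x1 - y1) + t * W (x2 - y2)"
      using t by (intro convex_onD[OF W]) auto
    finally have "env ?x \<le> (1 - t) * (a1 + W (x1 - y1)) + t * (a2 + W (x2 - y2))"
      using c(2) by (simp add: algebra_simps)
    also have "\<dots> \<le> (1 - t) * (env x1 + e) + t * (env x2 + e)"
      using 1(2) 2(2) t by (intro add_mono[OF mult_left_mono mult_left_mono]) auto
    finally show "env ?x \<le> (1 - t) * env x1 + t * env x2 + e"
      by (simp add: algebra_simps)
  qed
qed simp

text \<open>A near minimizer for the centre \<open>x\<close> is an admissible competitor for both \<open>x + u\<close> and
  \<open>x - u\<close>, and its \<open>F\<close> part cancels in the second difference.\<close>

lemma env_second_difference:
  assumes W: "\<And>a. W (a + u) + W (a - u) - 2 * W a \<le> C"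
  shows "env (x + u) + env (x - u) - 2 * env x \<le> C"
proof (rule field_le_epsilon)
  fix e :: real assume "0 < e"
  then have "0 < e / 2" by simp
  then obtain y a where y: "F y = ereal a" "a + W (x - y) < env x + e / 2"
    by (rule near_minimizer)
  show "env (x + u) + env (x - u) - 2 * env x \<le> C + e"
    using env_le[OF y(1), of "x + u"] env_le[OF y(1), of "x - u"] W[of "x - y"] y(2)
    by (simp add: algebra_simps)
qed

end

lemma inf_conv_perspective_upper:
  assumes "finite_inf_conv F (perspective \<omega> \<mu>1)" "finite_inf_conv F (perspective \<omega> \<mu>2)"
    and "convex_on UNIV \<omega>" "0 < \<mu>1" "\<mu>1 \<le> \<mu>2"
  shows "real_of_ereal (inf_conv F (perspective \<omega> \<mu>2) x)
    \<le> real_of_ereal (inf_conv F (perspective \<omega> \<mu>1) x) + (\<mu>2 - \<mu>1) * \<omega> 0"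
proof (rule field_le_epsilon)
  interpret E1: finite_inf_conv F "perspective \<omega> \<mu>1" by fact
  interpret E2: finite_inf_conv F "perspective \<omega> \<mu>2" by fact
  fix e :: real assume "0 < e"
  then obtain y a where "F y = ereal a" "a + perspective \<omega> \<mu>1 (x - y) < E1.env x + e"
    by (rule E1.near_minimizer)
  then show "E2.env x \<le> E1.env x + (\<mu>2 - \<mu>1) * \<omega> 0 + e"
    using E2.env_le[of y a x] perspective_le_add[OF assms(3-5), of "x - y"] by linarith
qed

text \<open>As a function of the smoothing parameter, the infimal convolution at \<open>x\<close> is convex, with
  value at most \<open>F x\<close> at parameter \<open>0\<close>: it lies below the chord from that value to the one at
  \<open>\<mu>2\<close>. If \<open>y\<close> is nearly optimal for \<open>\<mu>2\<close>, the competitor for \<open>\<mu>1\<close> is the point dividing the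
  segment from \<open>x\<close> to \<open>y\<close> in the ratio \<open>\<mu>1 / \<mu>2\<close>.\<close>

lemma inf_conv_perspective_chord:
  assumes "finite_inf_conv F (perspective \<omega> \<mu>1)" "finite_inf_conv F (perspective \<omega> \<mu>2)"
    and F: "F x = ereal a" and \<mu>: "0 < \<mu>1" "\<mu>1 \<le> \<mu>2"
  shows "real_of_ereal (inf_conv F (perspective \<omega> \<mu>1) x)
    \<le> (1 - \<mu>1 / \<mu>2) * a + \<mu>1 / \<mu>2 * real_of_ereal (inf_conv F (perspective \<omega> \<mu>2) x)"
proof (rule field_le_epsilon)
  interpret E1: finite_inf_conv F "perspective \<omega> \<mu>1" by fact
  interpret E2: finite_inf_conv F "perspective \<omega> \<mu>2" by fact
  define t where "t = \<mu>1 / \<mu>2"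
  have t: "0 < t" "t \<le> 1" using \<mu> by (auto simp: t_def)
  fix e :: real assume e: "0 < e"
  then obtain y b where y: "F y = ereal b" "b + perspective \<omega> \<mu>2 (x - y) < E2.env x + e"
    by (rule E2.near_minimizer)
  obtain c where c: "F ((1 - t) *\<^sub>R x + t *\<^sub>R y) = ereal c" "c \<le> (1 - t) * a + t * b"
    using proper_convexD[OF E1.proper F y(1), of t] t by auto
  have "E1.env x \<le> c + perspective \<omega> \<mu>1 (x - ((1 - t) *\<^sub>R x + t *\<^sub>R y))"
    by (rule E1.env_le[OF c(1)])
  also have "x - ((1 - t) *\<^sub>R x + t *\<^sub>R y) = t *\<^sub>R (x - y)" by (simp add: algebra_simps)
  also have "perspective \<omega> \<mu>1 (t *\<^sub>R (x - y)) = t * perspective \<omega> \<mu>2 (x - y)"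
    using \<mu> by (simp add: perspective_def t_def field_simps)
  finally have "E1.env x \<le> (1 - t) * a + t * (b + perspective \<omega> \<mu>2 (x - y))"
    using c(2) by (simp add: algebra_simps)
  also have "\<dots> \<le> (1 - t) * a + t * (E2.env x + e)"
    using y(2) t by (intro add_left_mono mult_left_mono) auto
  also have "\<dots> \<le> (1 - t) * a + t * E2.env x + e"
    using t e by (simp add: algebra_simps mult_left_le)
  finally show "E1.env x \<le> (1 - \<mu>1 / \<mu>2) * a + \<mu>1 / \<mu>2 * E2.env x + e"
    by (simp add: t_def)
qed

text \<open>A subgradient bounds \<open>F\<close> below by an affine function. Its infimal convolution with the perspective of
  \<open>\<omega>\<close> is the same affine function lowered by \<open>\<mu>\<close> times the conjugate of \<open>\<omega>\<close> at \<open>d\<close>.\<close>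

lemma inf_conv_subgradient_bound:
  assumes "finite_inf_conv F (perspective \<omega> \<mu>)" "0 < \<mu>"
    and F: "F x = ereal a" and d: "d \<in> subdifferential F x"
  shows "ereal ((a - real_of_ereal (inf_conv F (perspective \<omega> \<mu>) x)) / \<mu>) \<le> conjugate \<omega> d"
proof (rule ereal_le_epsilon2)
  interpret finite_inf_conv F "perspective \<omega> \<mu>" by fact
  fix e :: real assume "0 < e"
  then have "0 < \<mu> * e" using assms(2) by simp
  then obtain y b where y: "F y = ereal b" "b + perspective \<omega> \<mu> (x - y) < env x + \<mu> * e"
    by (rule near_minimizer)
  have "F x + ereal (d \<bullet> (y - x)) \<le> F y" using d by (simp add: subdifferential_def)
  then have "a + d \<bullet> (y - x) \<le> b" by (simp add: F y)
  moreover define w where "w = (x - y) /\<^sub>R \<mu>"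
  then have "x - y = \<mu> *\<^sub>R w" using assms(2) by simp
  then have "d \<bullet> (y - x) = - \<mu> * (w \<bullet> d)"
    by (metis inner_commute inner_minus_left inner_scaleR_left minus_diff_eq mult_minus_left)
  moreover have "b + \<mu> * \<omega> w < env x + \<mu> * e"
    using y(2) by (simp add: perspective_def w_def)
  ultimately have "a - env x \<le> \<mu> * (w \<bullet> d - \<omega> w + e)" by (simp add: algebra_simps)
  then have "(a - env x) / \<mu> \<le> w \<bullet> d - \<omega> w + e"
    using assms(2) by (simp add: field_simps)
  then have "ereal ((a - env x) / \<mu>) \<le> ereal (w \<bullet> d - \<omega> w) + ereal e" by simp
  also have "\<dots> \<le> conjugate \<omega> d + ereal e"
    unfolding conjugate_def by (intro add_right_mono SUP_upper) auto
  finally show "ereal ((a - env x) / \<mu>) \<le> conjugate \<omega> d + ereal e" .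
qed

section \<open>Expectations\<close>

lemma ereal_expectation_of_integrable:
  assumes f: "integrable P f" and F: "AE s in P. F s = ereal (f s)"
  shows "ereal_expectation P F = ereal (\<integral>s. f s \<partial>P)"
proof -
  have "(\<integral>\<^sup>+ s. e2ennreal (F s) \<partial>P) = (\<integral>\<^sup>+ s. ennreal (f s) \<partial>P)"
    and "(\<integral>\<^sup>+ s. e2ennreal (- F s) \<partial>P) = (\<integral>\<^sup>+ s. ennreal (- f s) \<partial>P)"
    using F by (auto intro!: nn_integral_cong_AE elim!: eventually_mono)
  moreover obtain p q where "0 \<le> p" "0 \<le> q"
    "(\<integral>\<^sup>+ s. ennreal (f s) \<partial>P) = ennreal p" "(\<integral>\<^sup>+ s. ennreal (- f s) \<partial>P) = ennreal q"
    using f unfolding real_integrable_def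
    by (metis ennreal_cases infinity_ennreal_def)
  ultimately show ?thesis
    using real_lebesgue_integral_def[OF f] by (simp add: ereal_expectation_def)
qed

lemma ereal_expectation_finite:
  assumes F: "F \<in> borel_measurable P" and finite: "\<bar>ereal_expectation P F\<bar> \<noteq> \<infinity>"
  shows "integrable P (\<lambda>s. real_of_ereal (F s))" "AE s in P. F s = ereal (real_of_ereal (F s))"
    and "ereal_expectation P F = ereal (\<integral>s. real_of_ereal (F s) \<partial>P)"
proof -
  have pos: "(\<integral>\<^sup>+ s. e2ennreal (F s) \<partial>P) \<noteq> \<infinity>" and neg: "(\<integral>\<^sup>+ s. e2ennreal (- F s) \<partial>P) \<noteq> \<infinity>"
    using finite unfolding ereal_expectation_def
    by (cases "\<integral>\<^sup>+ s. e2ennreal (F s) \<partial>P"; cases "\<integral>\<^sup>+ s. e2ennreal (- F s) \<partial>P"; simp)+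
  note [measurable] = F
  have "AE s in P. e2ennreal (F s) \<noteq> \<infinity>" "AE s in P. e2ennreal (- F s) \<noteq> \<infinity>"
    by (rule nn_integral_PInf_AE[OF _ pos] nn_integral_PInf_AE[OF _ neg], measurable)+
  then show AE: "AE s in P. F s = ereal (real_of_ereal (F s))"
  proof eventually_elim
    case (elim s) then show ?case by (cases "F s") auto
  qed
  have "(\<integral>\<^sup>+ s. ennreal (real_of_ereal (F s)) \<partial>P) = (\<integral>\<^sup>+ s. e2ennreal (F s) \<partial>P)"
    "(\<integral>\<^sup>+ s. ennreal (- real_of_ereal (F s)) \<partial>P) = (\<integral>\<^sup>+ s. e2ennreal (- F s) \<partial>P)"
    using AE by (auto intro!: nn_integral_cong_AE elim!: eventually_mono) (metis e2ennreal_ereal uminus_ereal.simps(1))+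
  then show int: "integrable P (\<lambda>s. real_of_ereal (F s))"
    using pos neg by (simp add: real_integrable_def)
  show "ereal_expectation P F = ereal (\<integral>s. real_of_ereal (F s) \<partial>P)"
    by (rule ereal_expectation_of_integrable[OF int AE])
qed

text \<open>The complement of the support is the union of the basic open sets of probability zero, of which
  there are countably many.\<close>

lemma (in prob_space) AE_in_rv_support:
  fixes \<xi> :: "'a \<Rightarrow> 'b::second_countable_topology"
  assumes [measurable]: "\<xi> \<in> borel_measurable M"
  shows "AE s in M. \<xi> s \<in> rv_support M \<xi>"
proof -
  obtain B :: "'b set set" where B: "countable B" "topological_basis B"
    using ex_countable_basis by blast
  define N where "N = {U \<in> B. measure M (\<xi> -` U \<inter> space M) = 0}"
  have open_B: "open U" if "U \<in> B" for U using B(2) that by (rule topological_basis_open)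
  have "AE s in M. \<xi> s \<notin> U" if "U \<in> N" for U
  proof (rule AE_I[of _ _ "\<xi> -` U \<inter> space M"])
    have "open U" using that open_B by (auto simp: N_def)
    then show "\<xi> -` U \<inter> space M \<in> sets M" by measurable
    show "emeasure M (\<xi> -` U \<inter> space M) = 0"
      using that by (simp add: N_def emeasure_eq_measure)
  qed auto
  moreover have "countable N" using B(1) by (simp add: N_def)
  ultimately have "AE s in M. \<forall>U\<in>N. \<xi> s \<notin> U" by (simp add: AE_ball_countable)
  then show ?thesis
  proof eventually_elim
    case (elim s)
    show ?case unfolding rv_support_def
    proof (intro CollectI allI impI)
      fix U assume U: "open U" "\<xi> s \<in> U"
      obtain V where V: "V \<in> B" "\<xi> s \<in> V" "V \<subseteq> U"
        using topological_basisE[OF B(2) U] by blast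
      have "0 < measure M (\<xi> -` V \<inter> space M)"
        using elim V by (auto simp: N_def less_le)
      also have "\<dots> \<le> measure M (\<xi> -` U \<inter> space M)"
        using V(3) measurable_sets[OF assms] U(1) by (intro finite_measure_mono) auto
      finally show "0 < measure M (\<xi> -` U \<inter> space M)" .
    qed
  qed
qed

text \<open>The variance is the second moment minus the squared norm of the mean.\<close>

lemma (in prob_space) second_moment_of_deviation_le:
  fixes p :: "'a \<Rightarrow> 'b::euclidean_space"
  assumes [measurable]: "p \<in> borel_measurable M" and B: "AE s in M. norm (p s) \<le> B"
  shows "integrable M (\<lambda>s. (norm (p s - expectation p))\<^sup>2)"
    and "(\<integral>s. (norm (p s - expectation p))\<^sup>2 \<partial>M) \<le> B\<^sup>2"
proof -
  have p: "integrable M p" using B by (intro integrable_const_bound[where B = B]) auto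
  have sq: "AE s in M. (norm (p s))\<^sup>2 \<le> B\<^sup>2"
    using B by eventually_elim (auto intro: power_mono)
  then have psq: "integrable M (\<lambda>s. (norm (p s))\<^sup>2)"
    by (intro integrable_const_bound[where B = "B\<^sup>2"]) auto
  have eq: "(norm (p s - expectation p))\<^sup>2
      = (norm (p s))\<^sup>2 - 2 * (p s \<bullet> expectation p) + (norm (expectation p))\<^sup>2" for s
    by (simp add: power2_norm_eq_inner inner_diff inner_commute)
  show "integrable M (\<lambda>s. (norm (p s - expectation p))\<^sup>2)"
    unfolding eq using p psq by simp
  have "(\<integral>s. (norm (p s - expectation p))\<^sup>2 \<partial>M)
      = (\<integral>s. (norm (p s))\<^sup>2 \<partial>M) - (norm (expectation p))\<^sup>2"
    unfolding eq using p psq by (simp add: prob_space power2_norm_eq_inner)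
  also have "\<dots> \<le> (\<integral>s. (norm (p s))\<^sup>2 \<partial>M)" by simp
  also have "\<dots> \<le> (\<integral>s. B\<^sup>2 \<partial>M)" using sq psq by (intro integral_mono_AE) auto
  finally show "(\<integral>s. (norm (p s - expectation p))\<^sup>2 \<partial>M) \<le> B\<^sup>2" by (simp add: prob_space)
qed

section \<open>Envelopes of random convex functions\<close>

text \<open>The extended-real random functions \<open>F s\<close> have finite mean \<open>h\<close> on \<open>X\<close>. Measurability of
  the infimal convolutions is assumed on the whole space, since their means have to be
  differentiated in the ambient space at points of \<open>X\<close>.\<close>

locale random_inf_conv = prob_space P for P :: "'s measure" +
  fixes X :: "'a::euclidean_space set" and F :: "'s \<Rightarrow> 'a \<Rightarrow> ereal"
    and \<omega> h :: "'a \<Rightarrow> real" and \<mu>bar L :: real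
  assumes convex_X: "convex X"
    and convex_\<omega>: "convex_on UNIV \<omega>" and L_pos: "0 < L" and smooth_\<omega>: "smooth_with L UNIV \<omega>"
    and AE_proper: "AE s in P. proper_convex (F s)"
    and F_measurable: "\<And>x. x \<in> X \<Longrightarrow> (\<lambda>s. F s x) \<in> borel_measurable P"
    and h_expectation: "\<And>x. x \<in> X \<Longrightarrow> ereal (h x) = ereal_expectation P (\<lambda>s. F s x)"
    and continuous_h: "continuous_on X h"
    and inf_conv_measurable: "\<And>\<mu> x. \<mu> \<in> {0<..\<mu>bar} \<Longrightarrow>
          (\<lambda>s. inf_conv (F s) (perspective \<omega> \<mu>) x) \<in> borel_measurable P"
    and AE_finite: "\<And>\<mu>. \<mu> \<in> {0<..\<mu>bar} \<Longrightarrow>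
          AE s in P. \<forall>x. \<bar>inf_conv (F s) (perspective \<omega> \<mu>) x\<bar> \<noteq> \<infinity>"
begin

definition val :: "'a \<Rightarrow> 's \<Rightarrow> real" where
  "val x s = real_of_ereal (F s x)"

definition env :: "real \<Rightarrow> 'a \<Rightarrow> 's \<Rightarrow> real" where
  "env \<mu> x s = real_of_ereal (inf_conv (F s) (perspective \<omega> \<mu>) x)"

definition expected_inf_conv :: "'a \<Rightarrow> real \<Rightarrow> ereal" where
  "expected_inf_conv x \<mu> = ereal_expectation P (\<lambda>s. inf_conv (F s) (perspective \<omega> \<mu>) x)"

definition mean_env :: "'a \<Rightarrow> real \<Rightarrow> real" where
  "mean_env x \<mu> = real_of_ereal (expected_inf_conv x \<mu>)"

lemma AE_finite_inf_conv:
  "\<mu> \<in> {0<..\<mu>bar} \<Longrightarrow> AE s in P. finite_inf_conv (F s) (perspective \<omega> \<mu>)"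
  using AE_proper AE_finite[of \<mu>] unfolding finite_inf_conv_def by auto

lemma
  assumes "x \<in> X"
  shows val_integrable: "integrable P (val x)"
    and AE_val: "AE s in P. F s x = ereal (val x s)"
    and h_eq: "h x = expectation (val x)"
proof -
  have "\<bar>ereal_expectation P (\<lambda>s. F s x)\<bar> \<noteq> \<infinity>"
    by (simp flip: h_expectation[OF assms])
  note * = ereal_expectation_finite[OF F_measurable[OF assms] this, folded val_def]
  show "integrable P (val x)" "AE s in P. F s x = ereal (val x s)"
    using *(1,2) by auto
  show "h x = expectation (val x)"
    using *(3) h_expectation[OF assms] by simp
qed

lemma env_measurable [measurable]:
  "\<mu> \<in> {0<..\<mu>bar} \<Longrightarrow> env \<mu> x \<in> borel_measurable P"
  using inf_conv_measurable[of \<mu> x] unfolding env_def by measurable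

lemma expected_inf_conv_eq:
  assumes "\<mu> \<in> {0<..\<mu>bar}" "integrable P (env \<mu> x)"
  shows "expected_inf_conv x \<mu> = ereal (expectation (env \<mu> x))"
  unfolding expected_inf_conv_def
proof (rule ereal_expectation_of_integrable[OF assms(2)])
  show "AE s in P. inf_conv (F s) (perspective \<omega> \<mu>) x = ereal (env \<mu> x s)"
    using AE_finite[OF assms(1)]
    by eventually_elim (simp add: env_def ereal_real)
qed

lemma mean_env_eq:
  assumes "\<mu> \<in> {0<..\<mu>bar}" "integrable P (env \<mu> x)"
  shows "mean_env x \<mu> = expectation (env \<mu> x)"
  using expected_inf_conv_eq[OF assms] by (simp add: mean_env_def)

lemma AE_env_le:
  assumes "x \<in> X" "\<mu> \<in> {0<..\<mu>bar}"
  shows "AE s in P. env \<mu> (x + u) s \<le> val x s + perspective \<omega> \<mu> u"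
  using AE_val[OF assms(1)] AE_finite_inf_conv[OF assms(2)]
proof eventually_elim
  case (elim s)
  then show ?case
    using finite_inf_conv.env_le[OF elim(2,1), of "x + u"] by (simp add: env_def)
qed

text \<open>Convexity at a midpoint is a lower bound for the envelope at \<open>x + u\<close> by its values at \<open>x\<close>
  and \<open>x - u\<close>.\<close>

lemma AE_env_midpoint:
  assumes "\<mu> \<in> {0<..\<mu>bar}"
  shows "AE s in P. 2 * env \<mu> x s \<le> env \<mu> (x + u) s + env \<mu> (x - u) s"
  using AE_finite_inf_conv[OF assms]
proof eventually_elim
  case (elim s)
  have "convex_on UNIV (\<lambda>x. env \<mu> x s)"
    using finite_inf_conv.convex_on_env[OF elim convex_on_perspective[OF convex_\<omega>]] assms
    by (simp add: env_def)
  from convex_onD[OF this, of "1/2" "x + u" "x - u"]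
  show ?case by (simp add: algebra_simps flip: scaleR_2)
qed

text \<open>The value of \<open>F s\<close> at the single point \<open>x0\<close> bounds the envelope above everywhere, by
  \<open>val x0 s\<close> plus a nonrandom constant. Midpoint convexity turns the upper bound at the
  reflected point into a lower bound. Thus the mean envelope is finite on the whole space even if
  \<open>X\<close> has empty interior.\<close>

lemma env_integrable:
  assumes x0: "x0 \<in> X" and \<mu>: "\<mu> \<in> {0<..\<mu>bar}" and int: "integrable P (env \<mu> x0)"
  shows "integrable P (env \<mu> x)"
proof -
  define u where "u = x - x0"
  define C where "C = \<bar>perspective \<omega> \<mu> u\<bar> + \<bar>perspective \<omega> \<mu> (- u)\<bar>"
  show ?thesis
  proof (rule Bochner_Integration.integrable_bound)
    show "integrable P (\<lambda>s. \<bar>val x0 s\<bar> + C + 2 * \<bar>env \<mu> x0 s\<bar>)"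
      using val_integrable[OF x0] int by auto
    show "AE s in P. norm (env \<mu> x s) \<le> norm (\<bar>val x0 s\<bar> + C + 2 * \<bar>env \<mu> x0 s\<bar>)"
      using AE_env_le[OF x0 \<mu>, of u] AE_env_le[OF x0 \<mu>, of "- u"] AE_env_midpoint[OF \<mu>, of x0 u]
    proof eventually_elim
      case (elim s)
      have "x0 + u = x" "x0 + - u = x0 - u" by (simp_all add: u_def)
      with elim show ?case by (simp add: C_def)
    qed
  qed (use \<mu> in measurable)
qed

text \<open>Convexity and the second-difference bound hold almost surely and are preserved by the
  expectation, so no differentiation under the integral sign is involved.\<close>

lemma smooth_mean_env:
  assumes x0: "x0 \<in> X" and \<mu>: "\<mu> \<in> {0<..\<mu>bar}" and int0: "integrable P (env \<mu> x0)"
  shows "convex_on UNIV (\<lambda>x. mean_env x \<mu>)" "smooth_with (L / \<mu>) UNIV (\<lambda>x. mean_env x \<mu>)"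
proof -
  have int: "integrable P (env \<mu> x)" for x by (rule env_integrable[OF assms])
  have eq: "(\<lambda>x. mean_env x \<mu>) = (\<lambda>x. expectation (env \<mu> x))"
    using mean_env_eq[OF \<mu> int] by auto
  show convex: "convex_on UNIV (\<lambda>x. mean_env x \<mu>)"
    unfolding eq
  proof (rule convex_onI)
    fix t :: real and x y :: 'a assume t: "0 < t" "t < 1"
    have "expectation (env \<mu> ((1 - t) *\<^sub>R x + t *\<^sub>R y))
        \<le> expectation (\<lambda>s. (1 - t) * env \<mu> x s + t * env \<mu> y s)"
    proof (rule integral_mono_AE)
      show "AE s in P. env \<mu> ((1 - t) *\<^sub>R x + t *\<^sub>R y) s \<le> (1 - t) * env \<mu> x s + t * env \<mu> y s"
        using AE_finite_inf_conv[OF \<mu>]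
      proof eventually_elim
        case (elim s)
        show ?case
          using convex_onD[OF finite_inf_conv.convex_on_env[OF elim
                convex_on_perspective[OF convex_\<omega>]], of t x y] \<mu> t
          by (simp add: env_def)
      qed
    qed (use int in auto)
    then show "expectation (env \<mu> ((1 - t) *\<^sub>R x + t *\<^sub>R y))
        \<le> (1 - t) * expectation (env \<mu> x) + t * expectation (env \<mu> y)"
      using int by simp
  qed simp
  have "expectation (env \<mu> (x + u)) + expectation (env \<mu> (x - u)) - 2 * expectation (env \<mu> x)
      \<le> L / \<mu> * (norm u)\<^sup>2" for x u
  proof -
    have "expectation (\<lambda>s. env \<mu> (x + u) s + env \<mu> (x - u) s - 2 * env \<mu> x s)
        \<le> expectation (\<lambda>s. L / \<mu> * (norm u)\<^sup>2)"
    proof (rule integral_mono_AE)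
      show "AE s in P. env \<mu> (x + u) s + env \<mu> (x - u) s - 2 * env \<mu> x s \<le> L / \<mu> * (norm u)\<^sup>2"
        using AE_finite_inf_conv[OF \<mu>]
      proof eventually_elim
        case (elim s)
        show ?case
          using finite_inf_conv.env_second_difference[OF elim
              perspective_second_difference[OF smooth_\<omega>]] \<mu>
          by (simp add: env_def)
      qed
    qed (use int in auto)
    then show ?thesis using int by (simp add: prob_space)
  qed
  then show "smooth_with (L / \<mu>) UNIV (\<lambda>x. mean_env x \<mu>)"
    using \<mu> L_pos mean_env_eq[OF \<mu> int]
    by (intro smooth_with_of_second_difference[OF convex]) auto
qed

lemma convex_on_h: "convex_on X h"
proof (rule convex_onI[OF _ convex_X])
  fix t :: real and x y assume t: "0 < t" "t < 1" and xy: "x \<in> X" "y \<in> X"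
  have z: "(1 - t) *\<^sub>R x + t *\<^sub>R y \<in> X"
    using convexD[OF convex_X xy, of "1 - t" t] t by simp
  have "expectation (val ((1 - t) *\<^sub>R x + t *\<^sub>R y))
      \<le> expectation (\<lambda>s. (1 - t) * val x s + t * val y s)"
  proof (rule integral_mono_AE)
    show "AE s in P. val ((1 - t) *\<^sub>R x + t *\<^sub>R y) s \<le> (1 - t) * val x s + t * val y s"
      using AE_proper AE_val[OF xy(1)] AE_val[OF xy(2)]
    proof eventually_elim
      case (elim s)
      then show ?case using proper_convexD[OF elim, of t] t by (force simp: val_def)
    qed
  qed (use val_integrable xy z in auto)
  then show "h ((1 - t) *\<^sub>R x + t *\<^sub>R y) \<le> (1 - t) * h x + t * h y"
    using val_integrable xy z by (simp add: h_eq)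
qed

text \<open>Convexity, smoothness and the gradient bound always hold for an integrable envelope; what depends
  on the assumptions on \<open>\<omega>\<close> is the dependence on the smoothing parameter. A linear rate of uniform
  approximation of \<open>h\<close> yields the joint limit, because \<open>h\<close> is continuous on \<open>X\<close>.\<close>

lemma smoothing_functionI:
  assumes int: "\<And>x \<mu>. x \<in> X \<Longrightarrow> \<mu> \<in> {0<..\<mu>bar} \<Longrightarrow> integrable P (env \<mu> x)"
    and approx: "\<And>x \<mu>. x \<in> X \<Longrightarrow> \<mu> \<in> {0<..\<mu>bar} \<Longrightarrow> \<bar>mean_env x \<mu> - h x\<bar> \<le> C * \<mu>"
    and "0 < \<kappa>"
    and lip: "\<And>x \<mu>1 \<mu>2. x \<in> X \<Longrightarrow> \<mu>1 \<in> {0<..\<mu>bar} \<Longrightarrow> \<mu>2 \<in> {0<..\<mu>bar} \<Longrightarrow> \<mu>1 \<le> \<mu>2 \<Longrightarrow>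
      \<bar>mean_env x \<mu>2 - mean_env x \<mu>1\<bar> \<le> \<kappa> * (\<mu>2 - \<mu>1)"
  shows "smoothing_function X \<mu>bar h mean_env \<kappa> 0 L"
  unfolding smoothing_function_def
proof (intro conjI ballI)
  show "convex_on X h" by (rule convex_on_h)
  show "0 < \<kappa>" "0 < L" by (fact \<open>0 < \<kappa>\<close> L_pos)+
next
  fix \<mu> assume \<mu>: "\<mu> \<in> {0<..\<mu>bar}"
  have diff: "differentiable_grad_on (\<lambda>x. mean_env x \<mu>) X"
    and lip: "(L / \<mu>)-lipschitz_on X (gradient (\<lambda>x. mean_env x \<mu>))"
    and "convex_on X (\<lambda>x. mean_env x \<mu>)"
  proof -
    have "smooth_with (L / \<mu>) UNIV (\<lambda>x. mean_env x \<mu>) \<and> convex_on UNIV (\<lambda>x. mean_env x \<mu>)"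
      if "x \<in> X" for x using smooth_mean_env[OF that \<mu> int[OF that \<mu>]] by simp
    moreover have "0 \<le> L / \<mu>" using \<mu> L_pos by simp
    ultimately show "differentiable_grad_on (\<lambda>x. mean_env x \<mu>) X"
      "(L / \<mu>)-lipschitz_on X (gradient (\<lambda>x. mean_env x \<mu>))"
      "convex_on X (\<lambda>x. mean_env x \<mu>)"
      using convex_X
      by (auto simp: smooth_with_def differentiable_grad_on_def lipschitz_on_def convex_on_def)
  qed
  then show "differentiable_grad_on (\<lambda>x. mean_env x \<mu>) X"
    "continuous_on X (gradient (\<lambda>x. mean_env x \<mu>))" "convex_on X (\<lambda>x. mean_env x \<mu>)"
    "(0 + L / \<mu>)-lipschitz_on X (gradient (\<lambda>x. mean_env x \<mu>))"
    by (auto intro: lipschitz_on_continuous_on)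
next
  fix x assume x: "x \<in> X"
  let ?A = "at (x, 0::real) within X \<times> {0<..\<mu>bar}"
  have "continuous_on (X \<times> UNIV) (\<lambda>p::'a \<times> real. h (fst p))"
    by (intro continuous_on_compose2[OF continuous_h] continuous_intros) auto
  then have "((\<lambda>p. h (fst p)) \<longlongrightarrow> h x) (at (x, 0::real) within X \<times> UNIV)"
    using x by (auto simp: continuous_on_def)
  then have h: "((\<lambda>p. h (fst p)) \<longlongrightarrow> h x) ?A"
    by (rule tendsto_within_subset) auto
  have "((\<lambda>p. mean_env (fst p) (snd p) - h (fst p)) \<longlongrightarrow> 0) ?A"
  proof (rule Lim_null_comparison)
    show "\<forall>\<^sub>F p in ?A. norm (mean_env (fst p) (snd p) - h (fst p)) \<le> C * snd p"
      using approx by (auto simp: eventually_at_filter intro!: always_eventually)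
    show "((\<lambda>p. C * snd p) \<longlongrightarrow> 0) ?A" by (auto intro!: tendsto_eq_intros)
  qed
  from tendsto_add[OF this h]
  show "((\<lambda>p. mean_env (fst p) (snd p)) \<longlongrightarrow> h x) ?A" by simp
next
  fix x \<mu>1 \<mu>2 assume "x \<in> X" "\<mu>1 \<in> {0<..\<mu>bar}" "\<mu>2 \<in> {0<..\<mu>bar}"
  then show "\<bar>mean_env x \<mu>2 - mean_env x \<mu>1\<bar> \<le> \<kappa> * \<bar>\<mu>1 - \<mu>2\<bar>"
    using lip[of x \<mu>1 \<mu>2] lip[of x \<mu>2 \<mu>1] by (cases "\<mu>1 \<le> \<mu>2") (auto simp: abs_minus_commute)
qed

lemma AE_env_upper:
  assumes "\<mu>1 \<in> {0<..\<mu>bar}" "\<mu>2 \<in> {0<..\<mu>bar}" "\<mu>1 \<le> \<mu>2"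
  shows "AE s in P. env \<mu>2 x s \<le> env \<mu>1 x s + (\<mu>2 - \<mu>1) * \<omega> 0"
  using AE_finite_inf_conv[OF assms(1)] AE_finite_inf_conv[OF assms(2)]
proof eventually_elim
  case (elim s)
  then show ?case
    using inf_conv_perspective_upper[OF elim convex_\<omega>, of x] assms by (simp add: env_def)
qed

lemma AE_env_chord:
  assumes "x \<in> X" "\<mu>1 \<in> {0<..\<mu>bar}" "\<mu>2 \<in> {0<..\<mu>bar}" "\<mu>1 \<le> \<mu>2"
  shows "AE s in P. env \<mu>1 x s \<le> (1 - \<mu>1 / \<mu>2) * val x s + \<mu>1 / \<mu>2 * env \<mu>2 x s"
  using AE_finite_inf_conv[OF assms(2)] AE_finite_inf_conv[OF assms(3)] AE_val[OF assms(1)]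
proof eventually_elim
  case (elim s)
  then show ?case
    using inf_conv_perspective_chord[OF elim(1,2,3)] assms by (simp add: env_def)
qed

lemma AE_env_le_val:
  assumes "x \<in> X" "\<mu> \<in> {0<..\<mu>bar}"
  shows "AE s in P. env \<mu> x s \<le> val x s + \<mu> * \<omega> 0"
  using AE_env_le[OF assms, of 0] by (simp add: perspective_def)

text \<open>A subgradient with nonpositive conjugate value shows that the envelope lies above \<open>F s\<close>. By the
  chord bound the envelope is then nondecreasing in the smoothing parameter, and its rate of growth
  is at most \<open>\<omega> 0\<close>.\<close>

theorem smoothing_of_nonpositive_conjugate:
  assumes conj: "\<And>y. y \<in> effective_domain (conjugate \<omega>) \<Longrightarrow> conjugate \<omega> y \<le> 0"
    and sub: "\<And>x. x \<in> X \<Longrightarrow>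
      AE s in P. subdifferential (F s) x \<inter> effective_domain (conjugate \<omega>) \<noteq> {}"
  shows "x \<in> X \<Longrightarrow> \<mu> \<in> {0<..\<mu>bar} \<Longrightarrow> integrable P (env \<mu> x)"
    and "0 < \<kappa> \<Longrightarrow> \<omega> 0 \<le> \<kappa> \<Longrightarrow> smoothing_function X \<mu>bar h mean_env \<kappa> 0 L"
proof -
  have lower: "AE s in P. val x s \<le> env \<mu> x s" if x: "x \<in> X" and \<mu>: "\<mu> \<in> {0<..\<mu>bar}" for x \<mu>
    using sub[OF x] AE_val[OF x] AE_finite_inf_conv[OF \<mu>]
  proof eventually_elim
    case (elim s)
    then obtain d where d: "d \<in> subdifferential (F s) x" "d \<in> effective_domain (conjugate \<omega>)"
      by auto
    have "ereal ((val x s - env \<mu> x s) / \<mu>) \<le> conjugate \<omega> d"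
      using inf_conv_subgradient_bound[OF elim(3) _ elim(2) d(1)] \<mu> by (simp add: env_def)
    also have "\<dots> \<le> ereal 0" using conj[OF d(2)] by (simp add: zero_ereal_def)
    finally show ?case using \<mu> by (simp add: divide_le_0_iff)
  qed
  show int: "integrable P (env \<mu> x)" if x: "x \<in> X" and \<mu>: "\<mu> \<in> {0<..\<mu>bar}" for x \<mu>
  proof (rule Bochner_Integration.integrable_bound)
    show "integrable P (\<lambda>s. \<bar>val x s\<bar> + \<bar>\<mu> * \<omega> 0\<bar>)" using val_integrable[OF x] by auto
    show "AE s in P. norm (env \<mu> x s) \<le> norm (\<bar>val x s\<bar> + \<bar>\<mu> * \<omega> 0\<bar>)"
      using lower[OF x \<mu>] AE_env_le_val[OF x \<mu>] by eventually_elim auto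
  qed (use \<mu> in measurable)
  show "smoothing_function X \<mu>bar h mean_env \<kappa> 0 L" if \<kappa>: "0 < \<kappa>" "\<omega> 0 \<le> \<kappa>"
  proof (rule smoothing_functionI[where C = \<kappa>])
    fix x \<mu> assume x: "x \<in> X" and \<mu>: "\<mu> \<in> {0<..\<mu>bar}"
    have "expectation (val x) \<le> expectation (env \<mu> x)"
      using val_integrable[OF x] int[OF x \<mu>] lower[OF x \<mu>] by (intro integral_mono_AE)
    moreover have "expectation (env \<mu> x) \<le> expectation (\<lambda>s. val x s + \<mu> * \<omega> 0)"
      using val_integrable[OF x] int[OF x \<mu>] AE_env_le_val[OF x \<mu>] by (intro integral_mono_AE) auto
    moreover have "\<mu> * \<omega> 0 \<le> \<mu> * \<kappa>" using \<kappa> \<mu> by (intro mult_left_mono) auto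
    ultimately show "\<bar>mean_env x \<mu> - h x\<bar> \<le> \<kappa> * \<mu>"
      using val_integrable[OF x]
      by (simp add: mean_env_eq[OF \<mu> int[OF x \<mu>]] h_eq[OF x] prob_space mult.commute)
  next
    fix x \<mu>1 \<mu>2
    assume x: "x \<in> X" and \<mu>: "\<mu>1 \<in> {0<..\<mu>bar}" "\<mu>2 \<in> {0<..\<mu>bar}" "\<mu>1 \<le> \<mu>2"
    have "expectation (env \<mu>1 x) \<le> expectation (env \<mu>2 x)"
    proof (rule integral_mono_AE)
      show "AE s in P. env \<mu>1 x s \<le> env \<mu>2 x s"
        using AE_env_chord[OF x \<mu>] lower[OF x \<mu>(2)]
      proof eventually_elim
        case (elim s)
        have "(1 - \<mu>1 / \<mu>2) * val x s \<le> (1 - \<mu>1 / \<mu>2) * env \<mu>2 x s"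
          using elim(2) \<mu> by (intro mult_left_mono) auto
        then show ?case using elim(1) by (simp add: algebra_simps)
      qed
    qed (use int x \<mu> in auto)
    moreover have "expectation (env \<mu>2 x) \<le> expectation (\<lambda>s. env \<mu>1 x s + (\<mu>2 - \<mu>1) * \<omega> 0)"
      using AE_env_upper[OF \<mu>] int x \<mu> by (intro integral_mono_AE) auto
    moreover have "(\<mu>2 - \<mu>1) * \<omega> 0 \<le> (\<mu>2 - \<mu>1) * \<kappa>"
      using \<kappa> \<mu> by (intro mult_left_mono) auto
    ultimately show "\<bar>mean_env x \<mu>2 - mean_env x \<mu>1\<bar> \<le> \<kappa> * (\<mu>2 - \<mu>1)"
      using int x \<mu> by (simp add: mean_env_eq prob_space mult.commute)
  qed (use int \<kappa> in auto)
qed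

definition slope_bound :: "'s \<Rightarrow> ereal" where
  "slope_bound s = (SUP x\<in>X. INF d\<in>subdifferential (F s) x. conjugate \<omega> d)"

text \<open>The average rate \<open>q\<close> at which the envelope decreases between parameters \<open>0\<close> and \<open>\<mu>\<close> is
  measurable and almost surely lies between \<open>0\<close> and \<open>slope_bound\<close>. The latter is a supremum over an
  uncountable set and not obviously measurable, so the comparison rests on monotonicity of the
  nonnegative integral for arbitrary functions.\<close>

lemma expected_slope_le:
  assumes \<omega>0: "\<omega> 0 \<le> 0" and D: "ereal_expectation P slope_bound < \<infinity>"
    and x: "x \<in> X" and \<mu>: "\<mu> \<in> {0<..\<mu>bar}"
  shows "integrable P (env \<mu> x)"
    and "ereal (expectation (\<lambda>s. (val x s - env \<mu> x s) / \<mu>)) \<le> ereal_expectation P slope_bound"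
proof -
  define q where "q s = (val x s - env \<mu> x s) / \<mu>" for s
  have [measurable]: "val x \<in> borel_measurable P" using val_integrable[OF x] by auto
  have q_meas[measurable]: "q \<in> borel_measurable P" unfolding q_def using \<mu> by measurable
  have conj_nonneg: "0 \<le> conjugate \<omega> d" for d
    unfolding conjugate_def using \<omega>0 by (intro SUP_upper2[of 0]) (auto simp: zero_ereal_def)
  have "0 \<le> slope_bound s" for s
    unfolding slope_bound_def using x conj_nonneg by (intro SUP_upper2[of x] INF_greatest) auto
  then have D_eq: "ereal_expectation P slope_bound = enn2ereal (\<integral>\<^sup>+ s. e2ennreal (slope_bound s) \<partial>P)"
    by (simp add: ereal_expectation_def e2ennreal_neg zero_ennreal.rep_eq)
  have q0: "AE s in P. 0 \<le> q s"
    using AE_env_le_val[OF x \<mu>]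
  proof eventually_elim
    case (elim s)
    moreover have "\<mu> * \<omega> 0 \<le> 0" using \<mu> \<omega>0 by (simp add: mult_nonneg_nonpos)
    ultimately show ?case using \<mu> by (simp add: q_def)
  qed
  have "AE s in P. ennreal (q s) \<le> e2ennreal (slope_bound s)"
    using AE_val[OF x] AE_finite_inf_conv[OF \<mu>]
  proof eventually_elim
    case (elim s)
    have "ereal (q s) \<le> (INF d\<in>subdifferential (F s) x. conjugate \<omega> d)"
      using inf_conv_subgradient_bound[OF elim(2) _ elim(1)] \<mu>
      by (intro INF_greatest) (auto simp: q_def env_def)
    also have "\<dots> \<le> slope_bound s" unfolding slope_bound_def using x by (rule SUP_upper)
    finally show ?case using e2ennreal_mono by fastforce
  qed
  then have le: "(\<integral>\<^sup>+ s. ennreal (q s) \<partial>P) \<le> (\<integral>\<^sup>+ s. e2ennreal (slope_bound s) \<partial>P)"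
    by (rule nn_integral_mono_AE)
  also have "\<dots> < \<infinity>" using D unfolding D_eq
    by (cases "\<integral>\<^sup>+ s. e2ennreal (slope_bound s) \<partial>P") auto
  finally have q: "integrable P q" using q0 by (intro integrableI_nonneg) auto
  then have "integrable P (\<lambda>s. val x s - \<mu> * q s)" using val_integrable[OF x] by auto
  moreover have "val x s - \<mu> * q s = env \<mu> x s" for s using \<mu> by (simp add: q_def)
  ultimately show "integrable P (env \<mu> x)" by simp
  have "0 \<le> expectation q" using q0 by (rule integral_nonneg_AE)
  then have "ereal (expectation q) = enn2ereal (\<integral>\<^sup>+ s. ennreal (q s) \<partial>P)"
    using nn_integral_eq_integral[OF q q0] by simp
  also have "\<dots> \<le> ereal_expectation P slope_bound" using le by (simp add: D_eq less_eq_ennreal.rep_eq)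
  finally show "ereal (expectation (\<lambda>s. (val x s - env \<mu> x s) / \<mu>)) \<le> ereal_expectation P slope_bound"
    by (simp add: q_def[abs_def])
qed

text \<open>With \<open>\<omega> 0 \<le> 0\<close> the envelope is nonincreasing in the smoothing parameter. As it is convex in
  the parameter, its decrease is steepest near \<open>0\<close>, and this rate is what the expected slope bound controls.\<close>

theorem smoothing_of_expected_slope:
  assumes \<omega>0: "\<omega> 0 \<le> 0" and D: "ereal_expectation P slope_bound \<le> ereal \<kappa>" and \<kappa>: "0 < \<kappa>"
  shows "smoothing_function X \<mu>bar h mean_env \<kappa> 0 L"
proof -
  have "ereal_expectation P slope_bound < \<infinity>" using D by auto
  note slope = expected_slope_le[OF \<omega>0 this]
  have int: "integrable P (env \<mu> x)" if "x \<in> X" "\<mu> \<in> {0<..\<mu>bar}" for x \<mu>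
    by (rule slope(1)[OF that])
  have gap: "h x - mean_env x \<mu> \<le> \<kappa> * \<mu>" if x: "x \<in> X" and \<mu>: "\<mu> \<in> {0<..\<mu>bar}" for x \<mu>
  proof -
    have "ereal (expectation (\<lambda>s. (val x s - env \<mu> x s) / \<mu>)) \<le> ereal \<kappa>"
      using slope(2)[OF x \<mu>] D by (rule order_trans)
    then have "(h x - mean_env x \<mu>) / \<mu> \<le> \<kappa>"
      using val_integrable[OF x] int[OF x \<mu>] by (simp add: h_eq[OF x] mean_env_eq[OF \<mu>])
    then show ?thesis using \<mu> by (simp add: divide_le_eq)
  qed
  show ?thesis
  proof (rule smoothing_functionI[where C = \<kappa>])
    fix x \<mu> assume x: "x \<in> X" and \<mu>: "\<mu> \<in> {0<..\<mu>bar}"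
    have "expectation (env \<mu> x) \<le> expectation (\<lambda>s. val x s + \<mu> * \<omega> 0)"
      using val_integrable[OF x] int[OF x \<mu>] AE_env_le_val[OF x \<mu>] by (intro integral_mono_AE) auto
    moreover have "\<mu> * \<omega> 0 \<le> 0" using \<mu> \<omega>0 by (simp add: mult_nonneg_nonpos)
    ultimately have "mean_env x \<mu> \<le> h x"
      using val_integrable[OF x] by (simp add: mean_env_eq[OF \<mu> int[OF x \<mu>]] h_eq[OF x] prob_space)
    then show "\<bar>mean_env x \<mu> - h x\<bar> \<le> \<kappa> * \<mu>" using gap[OF x \<mu>] by simp
  next
    fix x \<mu>1 \<mu>2
    assume x: "x \<in> X" and \<mu>: "\<mu>1 \<in> {0<..\<mu>bar}" "\<mu>2 \<in> {0<..\<mu>bar}" "\<mu>1 \<le> \<mu>2"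
    have "expectation (env \<mu>2 x) \<le> expectation (\<lambda>s. env \<mu>1 x s + (\<mu>2 - \<mu>1) * \<omega> 0)"
      using AE_env_upper[OF \<mu>] int x \<mu> by (intro integral_mono_AE) auto
    moreover have "(\<mu>2 - \<mu>1) * \<omega> 0 \<le> 0" using \<omega>0 \<mu> by (simp add: mult_nonneg_nonpos)
    ultimately have le: "mean_env x \<mu>2 \<le> mean_env x \<mu>1"
      using int x \<mu> by (simp add: mean_env_eq prob_space)
    have "expectation (env \<mu>1 x)
        \<le> expectation (\<lambda>s. (1 - \<mu>1 / \<mu>2) * val x s + \<mu>1 / \<mu>2 * env \<mu>2 x s)"
      using AE_env_chord[OF x \<mu>] int x \<mu> val_integrable by (intro integral_mono_AE) auto
    then have "mean_env x \<mu>1 \<le> (1 - \<mu>1 / \<mu>2) * h x + \<mu>1 / \<mu>2 * mean_env x \<mu>2"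
      using int x \<mu> val_integrable by (simp add: mean_env_eq h_eq)
    then have "mean_env x \<mu>1 - mean_env x \<mu>2 \<le> (1 - \<mu>1 / \<mu>2) * (h x - mean_env x \<mu>2)"
      by (simp add: algebra_simps)
    also have "\<dots> \<le> (1 - \<mu>1 / \<mu>2) * (\<kappa> * \<mu>2)"
      using gap[OF x \<mu>(2)] \<mu> by (intro mult_left_mono) auto
    also have "\<dots> = \<kappa> * (\<mu>2 - \<mu>1)" using \<mu> by (simp add: field_simps)
    finally show "\<bar>mean_env x \<mu>2 - mean_env x \<mu>1\<bar> \<le> \<kappa> * (\<mu>2 - \<mu>1)" using le by simp
  qed (use int \<kappa> in auto)
qed

text \<open>Freezing the minimizer \<open>v s\<close> gives a majorant of the envelope that is exact at \<open>x\<close> and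
  smooth with the stated gradient. Together with midpoint convexity this squeezes the increment of the
  envelope between two quadratics around the linear term. The squeeze passes to expectations and
  identifies the gradient of the mean with the mean of the gradients.\<close>

theorem GDERIV_mean_env:
  assumes x: "x \<in> X" and \<mu>: "\<mu> \<in> {0<..\<mu>bar}"
    and finite: "\<bar>expected_inf_conv x \<mu>\<bar> \<noteq> \<infinity>"
    and minimizer: "AE s in P.
      F s (v s) + ereal (perspective \<omega> \<mu> (x - v s)) = inf_conv (F s) (perspective \<omega> \<mu>) x"
    and p: "integrable P (\<lambda>s. gradient \<omega> ((x - v s) /\<^sub>R \<mu>))"
  shows "GDERIV (\<lambda>x. mean_env x \<mu>) x :> expectation (\<lambda>s. gradient \<omega> ((x - v s) /\<^sub>R \<mu>))"
proof (rule GDERIV_of_quadratic_bound)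
  let ?p = "\<lambda>s. gradient \<omega> ((x - v s) /\<^sub>R \<mu>)"
  have int: "integrable P (env \<mu> y)" for y
  proof (rule env_integrable[OF x \<mu>])
    show "integrable P (env \<mu> x)"
      using ereal_expectation_finite(1)[OF inf_conv_measurable[OF \<mu>]] finite
      by (simp add: expected_inf_conv_def env_def[abs_def])
  qed
  have upper: "AE s in P. env \<mu> (x + u) s \<le> env \<mu> x s + ?p s \<bullet> u + L / \<mu> / 2 * (norm u)\<^sup>2" for u
    using minimizer AE_finite_inf_conv[OF \<mu>]
  proof eventually_elim
    case (elim s)
    interpret E: finite_inf_conv "F s" "perspective \<omega> \<mu>" by (fact elim(2))
    obtain a where a: "F s (v s) = ereal a"
      using elim(1) E.finite[of x] by (cases "F s (v s)") auto
    then have "env \<mu> x s = a + perspective \<omega> \<mu> (x - v s)" using elim(1) by (simp add: env_def flip: elim(1))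
    moreover have "env \<mu> (x + u) s \<le> a + perspective \<omega> \<mu> ((x - v s) + u)"
      using E.env_le[OF a, of "x + u"] by (simp add: env_def algebra_simps)
    ultimately show ?case
      using perspective_quadratic_bound[OF smooth_\<omega>, of \<mu> "x - v s" u] \<mu> by simp
  qed
  fix u
  have "AE s in P. env \<mu> (x + u) s - env \<mu> x s - ?p s \<bullet> u \<le> L / \<mu> / 2 * (norm u)\<^sup>2"
    using upper[of u] by eventually_elim simp
  then have "expectation (\<lambda>s. env \<mu> (x + u) s - env \<mu> x s - ?p s \<bullet> u)
      \<le> expectation (\<lambda>s. L / \<mu> / 2 * (norm u)\<^sup>2)"
    using int p by (intro integral_mono_AE) auto
  moreover have "AE s in P. - (L / \<mu> / 2 * (norm u)\<^sup>2) \<le> env \<mu> (x + u) s - env \<mu> x s - ?p s \<bullet> u"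
    using upper[of "- u"] AE_env_midpoint[OF \<mu>, of x u] by eventually_elim simp
  then have "expectation (\<lambda>s. - (L / \<mu> / 2 * (norm u)\<^sup>2))
      \<le> expectation (\<lambda>s. env \<mu> (x + u) s - env \<mu> x s - ?p s \<bullet> u)"
    using int p by (intro integral_mono_AE) auto
  ultimately show "\<bar>mean_env (x + u) \<mu> - mean_env x \<mu> - expectation ?p \<bullet> u\<bar> \<le> L / \<mu> / 2 * (norm u)\<^sup>2"
    using int p by (simp add: mean_env_eq[OF \<mu>] prob_space abs_le_iff)
qed

end

section \<open>Smoothing by expected infimal convolution\<close>

theorem lemma4:
  fixes X Z :: "'a::euclidean_space set"
    and P :: "'s measure"
    and \<xi> :: "'s \<Rightarrow> 'b::euclidean_space"
    and \<Xi> :: "'b set"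
    and H :: "'a \<Rightarrow> 'b \<Rightarrow> ereal"
    and f h \<omega> :: "'a \<Rightarrow> real"
    and \<mu>bar \<sigma>\<omega> :: real
    and vhat :: "real \<Rightarrow> 'a \<Rightarrow> 'b \<Rightarrow> 'a"
  assumes "closed X" and "convex X"
    and "prob_space P" and "\<xi> \<in> borel_measurable P" and "\<Xi> = rv_support P \<xi>"
    and "\<And>z. z \<in> \<Xi> \<Longrightarrow> closed_proper_convex (\<lambda>x. H x z)"
    and "convex_on X f" and "\<exists>L. smooth_with L X f"
    and "\<mu>bar > 0"
    and "convex_on UNIV \<omega>" and "\<sigma>\<omega> > 0" and "smooth_with (1 / \<sigma>\<omega>) UNIV \<omega>"
    and "\<And>x. x \<in> X \<Longrightarrow> (\<lambda>s. H x (\<xi> s)) \<in> borel_measurable P"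
    and "\<And>x. x \<in> X \<Longrightarrow> ereal (h x) = ereal_expectation P (\<lambda>s. H x (\<xi> s))"
    and "continuous_on X h"
    and "\<And>\<mu> x. \<mu> \<in> {0<..\<mu>bar} \<Longrightarrow> (\<lambda>s. H_tilde H \<omega> \<mu> x (\<xi> s)) \<in> borel_measurable P"
    and "\<And>\<mu>. \<mu> \<in> {0<..\<mu>bar} \<Longrightarrow>
           AE s in P. \<xi> s \<in> \<Xi> \<longrightarrow>
             (\<forall>x. \<bar>H_tilde H \<omega> \<mu> x (\<xi> s)\<bar> \<noteq> \<infinity>) \<and> (INF x. H x (\<xi> s)) > -\<infinity>"
  shows
    "((\<forall>y\<in>effective_domain (conjugate \<omega>). conjugate \<omega> y \<le> 0) \<and>
      (\<forall>x\<in>X. AE s in P.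
         subdifferential (\<lambda>y. H y (\<xi> s)) x \<inter> effective_domain (conjugate \<omega>) \<noteq> {})
      \<longrightarrow>
        (\<forall>x\<in>X. \<forall>\<mu>\<in>{0<..\<mu>bar}. \<bar>expected_H_tilde P \<xi> H \<omega> x \<mu>\<bar> \<noteq> \<infinity>) \<and>
        (\<omega> 0 > 0 \<longrightarrow>
           smoothing_function X \<mu>bar h (h_tilde P \<xi> H \<omega>) (\<omega> 0) 0 (1 / \<sigma>\<omega>)) \<and>
        (\<omega> 0 \<le> 0 \<longrightarrow>
           (\<forall>\<kappa>>0. smoothing_function X \<mu>bar h (h_tilde P \<xi> H \<omega>) \<kappa> 0 (1 / \<sigma>\<omega>))))
     \<and>
     (\<omega> 0 \<le> 0 \<and> level_bounded \<omega> \<and>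
      (AE s in P. \<xi> s \<in> \<Xi> \<longrightarrow>
         lower_semicontinuous (\<lambda>x. H x (\<xi> s)) \<and> (INF x. H x (\<xi> s)) > -\<infinity>) \<and>
      D_const P \<xi> X H (conjugate \<omega>) < \<infinity>
      \<longrightarrow>
        (\<forall>x\<in>X. \<forall>\<mu>\<in>{0<..\<mu>bar}. \<bar>expected_H_tilde P \<xi> H \<omega> x \<mu>\<bar> \<noteq> \<infinity>) \<and>
        (D_const P \<xi> X H (conjugate \<omega>) > 0 \<longrightarrow>
           smoothing_function X \<mu>bar h (h_tilde P \<xi> H \<omega>)
             (real_of_ereal (D_const P \<xi> X H (conjugate \<omega>))) 0 (1 / \<sigma>\<omega>)) \<and>
        (D_const P \<xi> X H (conjugate \<omega>) \<le> 0 \<longrightarrow>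
           (\<forall>\<kappa>>0. smoothing_function X \<mu>bar h (h_tilde P \<xi> H \<omega>) \<kappa> 0 (1 / \<sigma>\<omega>))))
     \<and>
     ((\<forall>x\<in>X. \<forall>\<mu>\<in>{0<..\<mu>bar}.
         \<bar>expected_H_tilde P \<xi> H \<omega> x \<mu>\<bar> \<noteq> \<infinity> \<and>
         (AE s in P. inf_conv_objective H \<omega> \<mu> x (\<xi> s) (vhat \<mu> x (\<xi> s)) = H_tilde H \<omega> \<mu> x (\<xi> s)) \<and>
         (\<lambda>s. grad_H_tilde \<omega> vhat \<mu> x (\<xi> s)) \<in> borel_measurable P \<and>
         (AE s in P. (x - vhat \<mu> x (\<xi> s)) /\<^sub>R \<mu> \<in> Z)) \<and>
      bdd_above ((\<lambda>x. norm (gradient \<omega> x)) ` Z)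
      \<longrightarrow>
        unbiased_bounded_variance P \<xi> X \<mu>bar (psi_tilde P \<xi> H \<omega> f)
          (stoch_grad f \<omega> vhat) (SUP x\<in>Z. (norm (gradient \<omega> x))\<^sup>2))"
proof -
  interpret prob_space P by fact
  have support: "AE s in P. \<xi> s \<in> \<Xi>"
    unfolding \<open>\<Xi> = rv_support P \<xi>\<close> by (rule AE_in_rv_support) fact
  have AE_proper: "AE s in P. proper_convex (\<lambda>y. H y (\<xi> s))"
    using support
  proof eventually_elim
    case (elim s)
    then show ?case using assms(6) by (auto simp: closed_proper_convex_def proper_convex_def)
  qed
  interpret random_inf_conv P X "\<lambda>s y. H y (\<xi> s)" \<omega> h \<mu>bar "1 / \<sigma>\<omega>"
  proof
    fix \<mu> x assume \<mu>: "\<mu> \<in> {0<..\<mu>bar}"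
    show "(\<lambda>s. inf_conv (\<lambda>y. H y (\<xi> s)) (perspective \<omega> \<mu>) x) \<in> borel_measurable P"
      using assms(16)[OF \<mu>, of x] by (simp add: H_tilde_eq_inf_conv)
    show "AE s in P. \<forall>x. \<bar>inf_conv (\<lambda>y. H y (\<xi> s)) (perspective \<omega> \<mu>) x\<bar> \<noteq> \<infinity>"
      using assms(17)[OF \<mu>] support by eventually_elim (simp add: H_tilde_eq_inf_conv)
  qed (use assms AE_proper in auto)
  have expected_eq: "expected_H_tilde P \<xi> H \<omega> = expected_inf_conv"
    by (simp add: fun_eq_iff expected_H_tilde_def expected_inf_conv_def H_tilde_eq_inf_conv)
  have h_tilde_eq: "h_tilde P \<xi> H \<omega> = mean_env"
    by (simp add: fun_eq_iff h_tilde_def mean_env_def expected_eq)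
  have D_eq: "D_const P \<xi> X H (conjugate \<omega>) = ereal_expectation P slope_bound"
    by (simp add: D_const_def slope_bound_def[abs_def])
  have finiteI: "\<bar>expected_H_tilde P \<xi> H \<omega> x \<mu>\<bar> \<noteq> \<infinity>"
    if "\<mu> \<in> {0<..\<mu>bar}" "integrable P (env \<mu> x)" for x \<mu>
    using expected_inf_conv_eq[OF that] by (simp add: expected_eq)
  show ?thesis
  proof (intro conjI impI, goal_cases)
    case 1
    show ?case
      by (intro ballI finiteI smoothing_of_nonpositive_conjugate(1)) (use 1 in auto)
  next
    case 2
    then show ?case
      unfolding h_tilde_eq using smoothing_of_nonpositive_conjugate(2)[of "\<omega> 0"] by auto
  next
    case 3
    then show ?case
      unfolding h_tilde_eq using smoothing_of_nonpositive_conjugate(2) by auto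
  next
    case 4
    show ?case
      by (intro ballI finiteI expected_slope_le(1)) (use 4 in \<open>auto simp: D_eq\<close>)
  next
    case 5
    let ?D = "ereal_expectation P slope_bound"
    have "0 < ?D" "?D < \<infinity>" using 5 by (auto simp: D_eq)
    then obtain \<kappa> where "?D = ereal \<kappa>" "0 < \<kappa>" by (cases ?D) auto
    then show ?case
      unfolding h_tilde_eq D_eq using 5 smoothing_of_expected_slope[of \<kappa>] by simp
  next
    \<comment> \<open>A nonpositive expected slope is below every positive constant. This includes the empty
      set \<open>X\<close>, for which the expected slope is \<open>-\<infinity>\<close>.\<close>
    case 6
    show ?case unfolding h_tilde_eq
    proof (intro allI impI smoothing_of_expected_slope)
      fix \<kappa> :: real assume "0 < \<kappa>"
      moreover have "ereal_expectation P slope_bound \<le> ereal 0"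
        using 6(2) by (simp add: D_eq zero_ereal_def)
      ultimately show "ereal_expectation P slope_bound \<le> ereal \<kappa>"
        by (meson ereal_less_eq(3) less_imp_le order_trans)
    qed (use 6 in auto)
  next
    case 7
    show ?case unfolding unbiased_bounded_variance_def
    proof (intro ballI)
      fix x \<mu> assume x: "x \<in> X" and \<mu>: "\<mu> \<in> {0<..\<mu>bar}"
      let ?p = "\<lambda>s. grad_H_tilde \<omega> vhat \<mu> x (\<xi> s)"
      let ?\<psi> = "psi_tilde P \<xi> H \<omega> f \<mu>"
      define S where "S = (SUP x\<in>Z. (norm (gradient \<omega> x))\<^sup>2)"
      have finite: "\<bar>expected_inf_conv x \<mu>\<bar> \<noteq> \<infinity>"
        and minimizer: "AE s in P. H (vhat \<mu> x (\<xi> s)) (\<xi> s)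
            + ereal (perspective \<omega> \<mu> (x - vhat \<mu> x (\<xi> s)))
            = inf_conv (\<lambda>y. H y (\<xi> s)) (perspective \<omega> \<mu>) x"
        and p_meas: "?p \<in> borel_measurable P"
        and in_Z: "AE s in P. (x - vhat \<mu> x (\<xi> s)) /\<^sub>R \<mu> \<in> Z"
        using 7 x \<mu>
        by (simp_all add: expected_eq H_tilde_eq_inf_conv inf_conv_objective_def perspective_def)
      obtain B where B: "\<And>z. z \<in> Z \<Longrightarrow> norm (gradient \<omega> z) \<le> B"
        using 7 by (auto simp: bdd_above_def)
      have "bdd_above ((\<lambda>z. (norm (gradient \<omega> z))\<^sup>2) ` Z)"
        by (rule bdd_aboveI2[where M = "B\<^sup>2"]) (auto intro: power_mono B)
      then have S: "(norm (gradient \<omega> z))\<^sup>2 \<le> S" if "z \<in> Z" for z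
        unfolding S_def using that by (intro cSUP_upper)
      \<comment> \<open>The bound is taken as the square root of the supremum of the squares, so that its square is
        the required bound on the variance.\<close>
      have bound: "AE s in P. norm (?p s) \<le> sqrt S"
        using in_Z by eventually_elim (simp add: grad_H_tilde_def S real_le_rsqrt)
      have p_int: "integrable P ?p"
        using bound p_meas by (intro integrable_const_bound[where B = "sqrt S"])
      \<comment> \<open>A set containing a random point almost surely is nonempty.\<close>
      have S_nonneg: "0 \<le> S"
      proof -
        have "\<exists>s. (x - vhat \<mu> x (\<xi> s)) /\<^sub>R \<mu> \<in> Z"
          using eventually_happens'[OF ae_filter_bot in_Z] by blast
        then show ?thesis using S zero_le_power2 order_trans by blast
      qed
      have "\<exists>g. GDERIV f x :> g"
        using assms(8) x by (auto simp: smooth_with_def differentiable_grad_on_def)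
      then have "GDERIV f x :> gradient f x" using gradient_eqI by metis
      moreover have "GDERIV (\<lambda>x. h_tilde P \<xi> H \<omega> x \<mu>) x :> expectation ?p"
        using GDERIV_mean_env[OF x \<mu> finite minimizer] p_int
        by (simp add: h_tilde_eq grad_H_tilde_def)
      ultimately have G: "GDERIV ?\<psi> x :> gradient f x + expectation ?p"
        unfolding psi_tilde_def by (rule GDERIV_add)
      then have grad: "gradient ?\<psi> x = gradient f x + expectation ?p"
        by (rule gradient_eqI)
      show "(\<exists>g. GDERIV ?\<psi> x :> g) \<and>
        integrable P (\<lambda>s. stoch_grad f \<omega> vhat \<mu> x (\<xi> s)) \<and>
        (\<integral>s. stoch_grad f \<omega> vhat \<mu> x (\<xi> s) \<partial>P) = gradient ?\<psi> x \<and>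
        integrable P (\<lambda>s. (norm (stoch_grad f \<omega> vhat \<mu> x (\<xi> s) - gradient ?\<psi> x))\<^sup>2) \<and>
        (\<integral>s. (norm (stoch_grad f \<omega> vhat \<mu> x (\<xi> s) - gradient ?\<psi> x))\<^sup>2 \<partial>P)
          \<le> (SUP x\<in>Z. (norm (gradient \<omega> x))\<^sup>2)"
        using G p_int second_moment_of_deviation_le[OF p_meas bound] S_nonneg
        by (auto simp: grad stoch_grad_def prob_space simp flip: S_def)
    qed
  qed
qed

end
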